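(* Let $K$ be an algebraically closed field, let $d \geq 2$ be an integer, let $V_1,\ldots,V_d$ be finite-dimensional vector spaces over $K$, and let $r$ be a nonnegative integer. Then the set $X_r \subseteq V_1 \otimes \cdots \otimes V_d$ of tensors of border subrank precisely $r$ is a constructible set (in the Zariski topology). Therefore, the same holds for the set $X_{<r}$ of tensors of border subrank strictly less than $r$ and for the set $X_{\geq r}$ of tensors of border subrank at least $r$.
   Context: For a nonnegative integer $r$, let $e_1,\ldots,e_r$ be the standard basis of $K^r$; the $r$-th unit tensor is $I_r := \sum_{i=1}^r e_i^{\otimes d} \in (K^r)^{\otimes d}$. The border subrank of a tensor $T \in V_1 \otimes \cdots \otimes V_d$ is the maximal $r$ for which $I_r$ lies in the Zariski closure (in $(K^r)^{\otimes d}$) of the set $\{(\phi_1 \otimes \cdots \otimes \phi_d)T \mid \phi_i \in \mathrm{Hom}(V_i,K^r),\ i=1,\ldots,d\}$. *)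

theory Defs
  imports
    "HOL-Analysis.Abstract_Topology"
    "HOL-Computational_Algebra.Polynomial"
    "HOL-Library.Function_Algebras"
    "HOL-Library.FuncSet"
begin

text \<open>
  A vector space over the field \<open>'k\<close> is a subspace of a type \<open>'v\<close> carrying a scalar multiplication
  \<open>s\<close> with \<open>vector_space s\<close>.  A family of vector spaces is a family of subspaces of one
  type; any family arises in this way up to isomorphism (embed it into its direct sum).  Linear
  maps and functionals on a subspace are represented by linear maps on all of \<open>'v\<close>; every
  linear map on a subspace has such an extension.
\<close>

definition fscale :: "'k::field \<Rightarrow> ('a \<Rightarrow> 'k) \<Rightarrow> ('a \<Rightarrow> 'k)" where
  "fscale c f = (\<lambda>x. c * f x)"

lemma fscale_apply [simp]: "fscale c f x = c * f x"
  by (simp add: fscale_def)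

lemma vector_space_fscale: "vector_space fscale"
  by unfold_locales (auto simp: fun_eq_iff algebra_simps)

lemma vector_space_times: "vector_space ((*) :: 'k::field \<Rightarrow> 'k \<Rightarrow> 'k)"
  by unfold_locales (auto simp: algebra_simps)

abbreviation functional :: "('k::field \<Rightarrow> 'v::ab_group_add \<Rightarrow> 'v) \<Rightarrow> ('v \<Rightarrow> 'k) \<Rightarrow> bool" where
  "functional s \<equiv> Vector_Spaces.linear s (*)"

definition finite_dimensional ::
    "('k::field \<Rightarrow> 'v::ab_group_add \<Rightarrow> 'v) \<Rightarrow> 'v set \<Rightarrow> bool" where
  "finite_dimensional s V \<longleftrightarrow> (\<exists>B. finite B \<and> B \<subseteq> V \<and> V \<subseteq> module.span s B)"


subsection \<open>Tensor products\<close>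

text \<open>
  The tensor \<open>v 1 \<otimes> \<dots> \<otimes> v d\<close> is realised as the multilinear form sending functionals
  \<open>\<xi> 1, \<dots>, \<xi> d\<close> to \<open>\<xi> 1 (v 1) * \<dots> * \<xi> d (v d)\<close> (set to 0 when some \<open>\<xi> i\<close> is not linear), and
  the tensor product is the span of these.  The universal property is
  \<open>tensor_space_universal\<close> below.
\<close>

definition pure_tensor ::
    "('k::field \<Rightarrow> 'v::ab_group_add \<Rightarrow> 'v) \<Rightarrow> nat \<Rightarrow> (nat \<Rightarrow> 'v) \<Rightarrow> (nat \<Rightarrow> 'v \<Rightarrow> 'k) \<Rightarrow> 'k" where
  "pure_tensor s d v =
     (\<lambda>\<xi>. if \<forall>i\<in>{1..d}. functional s (\<xi> i) then \<Prod>i=1..d. \<xi> i (v i) else 0)"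

definition tensor_space ::
    "('k::field \<Rightarrow> 'v::ab_group_add \<Rightarrow> 'v) \<Rightarrow> nat \<Rightarrow> (nat \<Rightarrow> 'v set) \<Rightarrow> ((nat \<Rightarrow> 'v \<Rightarrow> 'k) \<Rightarrow> 'k) set" where
  "tensor_space s d V = module.span fscale (pure_tensor s d ` (\<Pi>\<^sub>E i\<in>{1..d}. V i))"

text \<open>
  The map \<open>\<phi> 1 \<otimes> \<dots> \<otimes> \<phi> d\<close>, for linear maps into a space with scalar multiplication \<open>s'\<close>.
\<close>

definition tensor_map ::
    "('k::field \<Rightarrow> 'w::ab_group_add \<Rightarrow> 'w) \<Rightarrow> nat \<Rightarrow> (nat \<Rightarrow> 'v \<Rightarrow> 'w) \<Rightarrow>
     ((nat \<Rightarrow> 'v \<Rightarrow> 'k) \<Rightarrow> 'k) \<Rightarrow> (nat \<Rightarrow> 'w \<Rightarrow> 'k) \<Rightarrow> 'k" where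
  "tensor_map s' d \<phi> T =
     (\<lambda>\<eta>. if \<forall>i\<in>{1..d}. functional s' (\<eta> i) then T (\<lambda>i. \<eta> i \<circ> \<phi> i) else 0)"

lemma linear_tensor_map: "Vector_Spaces.linear fscale fscale (tensor_map s' d \<phi>)"
  by (auto simp: Vector_Spaces.linear_iff vector_space_fscale tensor_map_def fun_eq_iff)

lemma tensor_map_pure_tensor:
  assumes "\<And>i. i \<in> {1..d} \<Longrightarrow> Vector_Spaces.linear s s' (\<phi> i)"
  shows "tensor_map s' d \<phi> (pure_tensor s d v) = pure_tensor s' d (\<lambda>i. \<phi> i (v i))"
proof
  fix \<eta>
  have "functional s (\<eta> i \<circ> \<phi> i)" if "i \<in> {1..d}" "functional s' (\<eta> i)" for i
    using assms[OF that(1)] that(2) by (rule Vector_Spaces.linear_compose)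
  then show "tensor_map s' d \<phi> (pure_tensor s d v) \<eta> = pure_tensor s' d (\<lambda>i. \<phi> i (v i)) \<eta>"
    by (simp add: tensor_map_def pure_tensor_def)
qed

definition multilinear_on ::
    "('k::field \<Rightarrow> 'v::ab_group_add \<Rightarrow> 'v) \<Rightarrow> ('k \<Rightarrow> 'w::ab_group_add \<Rightarrow> 'w) \<Rightarrow>
     nat \<Rightarrow> (nat \<Rightarrow> 'v set) \<Rightarrow> ((nat \<Rightarrow> 'v) \<Rightarrow> 'w) \<Rightarrow> bool" where
  "multilinear_on s s' d V f \<longleftrightarrow>
     (\<forall>v\<in>(\<Pi>\<^sub>E i\<in>{1..d}. V i). \<forall>i\<in>{1..d}.
        (\<forall>x\<in>V i. \<forall>y\<in>V i. f (v(i := x + y)) = f (v(i := x)) + f (v(i := y))) \<and>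
        (\<forall>c. \<forall>x\<in>V i. f (v(i := s c x)) = s' c (f (v(i := x)))))"

lemma prod_fun_upd:
  fixes g :: "nat \<Rightarrow> 'v \<Rightarrow> 'k::comm_monoid_mult"
  assumes "i \<in> {1..d}"
  shows "(\<Prod>j=1..d. g j ((v(i := x)) j)) = g i x * (\<Prod>j\<in>{1..d} - {i}. g j (v j))"
  using assms by (simp add: prod.remove[of _ i])

lemma multilinear_pure_tensor: "multilinear_on s fscale d V (pure_tensor s d)"
proof -
  have "pure_tensor s d (v(i := x + y)) = pure_tensor s d (v(i := x)) + pure_tensor s d (v(i := y))"
    and "pure_tensor s d (v(i := s c x)) = fscale c (pure_tensor s d (v(i := x)))"
    if i: "i \<in> {1..d}" for v i x y c
  proof -
    have *: "\<xi> i (x + y) = \<xi> i x + \<xi> i y" "\<xi> i (s c x) = c * \<xi> i x"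
      if "\<forall>i\<in>{1..d}. functional s (\<xi> i)" for \<xi> :: "nat \<Rightarrow> 'b \<Rightarrow> 'a"
    proof -
      interpret Vector_Spaces.linear s "(*)" "\<xi> i" using that i by blast
      show "\<xi> i (x + y) = \<xi> i x + \<xi> i y" "\<xi> i (s c x) = c * \<xi> i x"
        by (rule add, rule scale)
    qed
    show "pure_tensor s d (v(i := x + y)) =
        pure_tensor s d (v(i := x)) + pure_tensor s d (v(i := y))"
      by (rule ext) (auto simp: pure_tensor_def prod_fun_upd[OF i] * algebra_simps
          simp del: fun_upd_apply One_nat_def)
    show "pure_tensor s d (v(i := s c x)) = fscale c (pure_tensor s d (v(i := x)))"
      by (rule ext) (auto simp: pure_tensor_def prod_fun_upd[OF i] * algebra_simps
          simp del: fun_upd_apply One_nat_def)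
  qed
  then show ?thesis by (auto simp: multilinear_on_def)
qed

lemma tensor_space_universal:
  fixes s :: "'k::field \<Rightarrow> 'v::ab_group_add \<Rightarrow> 'v" and s' :: "'k \<Rightarrow> 'w::ab_group_add \<Rightarrow> 'w"
  assumes "vector_space s" "vector_space s'"
    and V: "\<And>i. i \<in> {1..d} \<Longrightarrow> module.subspace s (V i)"
    and f: "multilinear_on s s' d V f"
  shows "\<exists>g. Vector_Spaces.linear fscale s' g \<and>
             (\<forall>v\<in>(\<Pi>\<^sub>E i\<in>{1..d}. V i). g (pure_tensor s d v) = f v) \<and>
             (\<forall>h. Vector_Spaces.linear fscale s' h \<longrightarrow>
                  (\<forall>v\<in>(\<Pi>\<^sub>E i\<in>{1..d}. V i). h (pure_tensor s d v) = f v) \<longrightarrow>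
                  (\<forall>T\<in>tensor_space s d V. h T = g T))"
proof -
  interpret S: vector_space s by fact
  interpret S': vector_space s' by fact
  interpret D: vector_space_pair s "(*) :: 'k \<Rightarrow> 'k \<Rightarrow> 'k"
    by (rule vector_space_pair.intro[OF assms(1) vector_space_times])
  interpret F: vector_space_pair "fscale :: 'k \<Rightarrow> ((nat \<Rightarrow> 'v \<Rightarrow> 'k) \<Rightarrow> 'k) \<Rightarrow> _" s'
    by (rule vector_space_pair.intro[OF vector_space_fscale assms(2)])
  have "\<exists>B. B \<subseteq> V i \<and> S.independent B \<and> V i \<subseteq> S.span B" for i
    by (rule S.maximal_independent_subset[of "V i"]) blast
  then obtain B where B: "\<And>i. B i \<subseteq> V i" "\<And>i. S.independent (B i)" "\<And>i. V i \<subseteq> S.span (B i)"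
    by metis
  define E where "E = (\<Pi>\<^sub>E i\<in>{1..d}. B i)"
  define \<xi> where "\<xi> b i = D.construct (B i) (\<lambda>x. if x = b i then 1 else 0)" for b :: "nat \<Rightarrow> 'v" and i
  have lin: "functional s (\<xi> b i)" for b i
    unfolding \<xi>_def by (rule D.linear_construct[OF B(2)])
  have ev: "pure_tensor s d b' (\<xi> b) = (if b' = b then 1 else 0)" if "b \<in> E" "b' \<in> E" for b b'
  proof -
    have "\<xi> b i (b' i) = (if b' i = b i then 1 else 0)" if "i \<in> {1..d}" for i
      unfolding \<xi>_def using that \<open>b' \<in> E\<close>
      by (subst D.construct_basis[OF B(2)]) (auto simp: E_def)
    then have "pure_tensor s d b' (\<xi> b) = (\<Prod>i=1..d. if b' i = b i then 1 else 0)"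
      by (auto simp: pure_tensor_def lin intro!: prod.cong)
    also have "\<dots> = (if b' = b then 1 else 0)"
    proof (cases "b' = b")
      case False
      have "\<exists>i\<in>{1..d}. b' i \<noteq> b i"
        using False PiE_ext[OF \<open>b' \<in> E\<close>[unfolded E_def] \<open>b \<in> E\<close>[unfolded E_def]] by blast
      then show ?thesis using False by (auto intro!: prod_zero)
    qed simp
    finally show ?thesis .
  qed
  have inj: "inj_on (pure_tensor s d) E"
  proof (rule inj_onI)
    fix b b' assume b: "b \<in> E" "b' \<in> E" and eq: "pure_tensor s d b = pure_tensor s d b'"
    have "pure_tensor s d b (\<xi> b') = 1" using ev[of b' b'] b eq by simp
    with ev[of b' b] b show "b = b'" by (simp split: if_splits)
  qed
  have indep: "F.vs1.independent (pure_tensor s d ` E)"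
    unfolding F.vs1.dependent_def
  proof safe
    fix b assume b: "b \<in> E"
      and sp: "pure_tensor s d b \<in> F.vs1.span (pure_tensor s d ` E - {pure_tensor s d b})"
    have "pure_tensor s d b (\<xi> b) = 0"
      using sp
    proof (induction rule: F.vs1.span_induct_alt)
      case (step c x y)
      then obtain b' where "b' \<in> E" "b' \<noteq> b" "x = pure_tensor s d b'" by blast
      then show ?case using step ev[OF b] by simp
    qed simp
    with ev[OF b b] show False by simp
  qed
  obtain g where g: "Vector_Spaces.linear fscale s' g"
    and gE: "\<And>T. T \<in> pure_tensor s d ` E \<Longrightarrow> g T = f (inv_into E (pure_tensor s d) T)"
    using F.linear_independent_extend[OF indep, of "\<lambda>T. f (inv_into E (pure_tensor s d) T)"] by blast
  interpret g: Vector_Spaces.linear fscale s' g by fact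
  have gpure: "m \<le> d \<Longrightarrow> v \<in> (\<Pi>\<^sub>E i\<in>{1..d}. V i) \<Longrightarrow> (\<And>i. i \<in> {1..d} \<Longrightarrow> m < i \<Longrightarrow> v i \<in> B i) \<Longrightarrow>
      g (pure_tensor s d v) = f v" for m v
  proof (induction m arbitrary: v)
    case 0
    then have "v \<in> E" by (auto simp: E_def PiE_iff)
    then show ?case using gE[of "pure_tensor s d v"] inj by simp
  next
    case (Suc m)
    let ?i = "Suc m"
    have i: "?i \<in> {1..d}" using Suc.prems by simp
    have upd: "v(?i := x) \<in> (\<Pi>\<^sub>E i\<in>{1..d}. V i)" if "x \<in> V ?i" for x
      using Suc.prems(2) i that by (auto simp: PiE_iff extensional_def)
    note pt = multilinear_pure_tensor[of s d V, unfolded multilinear_on_def, rule_format, OF Suc.prems(2) i]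
    note ft = f[unfolded multilinear_on_def, rule_format, OF Suc.prems(2) i]
    note Vi = V[OF i]
    have "x \<in> V ?i \<and> g (pure_tensor s d (v(?i := x))) = f (v(?i := x))" if "x \<in> S.span (B ?i)" for x
      using that
    proof (induction rule: S.span_induct_alt)
      case base
      have 0: "0 \<in> V ?i" using S.subspace_0[OF Vi] .
      have "pure_tensor s d (v(?i := 0)) = 0" "f (v(?i := 0)) = 0"
        using conjunct2[OF pt, rule_format, OF 0, of 0] conjunct2[OF ft, rule_format, OF 0, of 0]
        by (auto simp: fun_eq_iff)
      then show ?case using 0 by (simp only: g.zero simp_thms)
    next
      case (step c x y)
      then have x: "x \<in> V ?i" and y: "y \<in> V ?i" using B(1) by auto
      have cx: "s c x \<in> V ?i" using S.subspace_scale[OF Vi x] .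
      have "g (pure_tensor s d (v(?i := x))) = f (v(?i := x))"
        by (rule Suc.IH) (use Suc.prems step upd[OF x] in auto)
      then have "g (pure_tensor s d (v(?i := s c x + y))) = f (v(?i := s c x + y))"
        using step conjunct1[OF pt, rule_format, OF cx y] conjunct1[OF ft, rule_format, OF cx y]
          conjunct2[OF pt, rule_format, OF x, of c] conjunct2[OF ft, rule_format, OF x, of c]
        by (simp only: g.add g.scale simp_thms)
      then show ?case using S.subspace_add[OF Vi cx y] by blast
    qed
    moreover have "v ?i \<in> S.span (B ?i)"
      using PiE_mem[OF Suc.prems(2) i] B(3) by blast
    ultimately show ?case by (metis fun_upd_triv)
  qed
  have "h T = g T" if h: "Vector_Spaces.linear fscale s' h"
    "\<forall>v\<in>(\<Pi>\<^sub>E i\<in>{1..d}. V i). h (pure_tensor s d v) = f v" and T: "T \<in> tensor_space s d V" for h T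
    by (rule F.linear_eq_on[OF h(1) g T[unfolded tensor_space_def]])
      (use gpure[of d] h(2) in auto)
  then show ?thesis using g gpure[of d] by (intro exI[of _ g]) auto
qed


subsection \<open>The Zariski topology on a finite-dimensional vector space\<close>

inductive_set polynomial_functions ::
    "('k::field \<Rightarrow> 'v::ab_group_add \<Rightarrow> 'v) \<Rightarrow> ('v \<Rightarrow> 'k) set" for s where
  const: "(\<lambda>_. c) \<in> polynomial_functions s"
| linear: "functional s l \<Longrightarrow> l \<in> polynomial_functions s"
| add: "p \<in> polynomial_functions s \<Longrightarrow> q \<in> polynomial_functions s \<Longrightarrow>
    (\<lambda>x. p x + q x) \<in> polynomial_functions s"
| mult: "p \<in> polynomial_functions s \<Longrightarrow> q \<in> polynomial_functions s \<Longrightarrow>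
    (\<lambda>x. p x * q x) \<in> polynomial_functions s"

definition zariski ::
    "('k::field \<Rightarrow> 'v::ab_group_add \<Rightarrow> 'v) \<Rightarrow> 'v set \<Rightarrow> 'v topology" where
  "zariski s W =
     topology (\<lambda>U. \<exists>P\<subseteq>polynomial_functions s. U = W - {x \<in> W. \<forall>p\<in>P. p x = 0})"

lemma openin_zariski:
  "openin (zariski s W) U \<longleftrightarrow>
     (\<exists>P\<subseteq>polynomial_functions s. U = W - {x \<in> W. \<forall>p\<in>P. p x = 0})"
proof -
  let ?L = "\<lambda>U. \<exists>P\<subseteq>polynomial_functions s. U = W - {x \<in> W. \<forall>p\<in>P. p x = 0}"
  have "?L (S \<inter> T)" if S: "?L S" and T: "?L T" for S T
  proof -
    obtain P where P: "P \<subseteq> polynomial_functions s" "S = W - {x \<in> W. \<forall>p\<in>P. p x = 0}"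
      using S by blast
    obtain Q where Q: "Q \<subseteq> polynomial_functions s" "T = W - {x \<in> W. \<forall>q\<in>Q. q x = 0}"
      using T by blast
    have "S \<inter> T = W - {x \<in> W. \<forall>h\<in>(\<lambda>(p, q) x. p x * q x) ` (P \<times> Q). h x = 0}"
      unfolding P(2) Q(2) by (auto simp: image_iff)
    moreover have "(\<lambda>(p, q) x. p x * q x) ` (P \<times> Q) \<subseteq> polynomial_functions s"
      using P(1) Q(1) by (auto intro!: polynomial_functions.mult)
    ultimately show ?thesis by blast
  qed
  moreover have "?L (\<Union>\<K>)" if \<K>: "\<forall>K\<in>\<K>. ?L K" for \<K>
  proof -
    obtain P where P: "\<forall>K\<in>\<K>. P K \<subseteq> polynomial_functions s \<and>
        K = W - {x \<in> W. \<forall>p\<in>P K. p x = 0}"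
      using bchoice[OF \<K>] by (rule exE)
    have "(\<Union>K\<in>\<K>. K) = (\<Union>K\<in>\<K>. W - {x \<in> W. \<forall>p\<in>P K. p x = 0})"
      by (rule SUP_cong[OF refl]) (rule conjunct2[OF bspec[OF P]])
    also have "\<dots> = W - {x \<in> W. \<forall>p\<in>(\<Union>K\<in>\<K>. P K). p x = 0}"
      by auto
    finally have "\<Union>\<K> = W - {x \<in> W. \<forall>p\<in>(\<Union>K\<in>\<K>. P K). p x = 0}"
      by simp
    moreover have "(\<Union>K\<in>\<K>. P K) \<subseteq> polynomial_functions s"
      by (rule UN_least) (rule conjunct1[OF bspec[OF P]])
    ultimately show ?thesis by blast
  qed
  ultimately have "istopology ?L"
    unfolding istopology_def by (intro conjI allI impI)
  then show ?thesis by (simp add: zariski_def)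
qed

lemma topspace_zariski [simp]: "topspace (zariski s W) = W"
proof -
  have "openin (zariski s W) W"
    unfolding openin_zariski
    by (intro exI[of _ "{\<lambda>_. 1}"]) (auto intro: polynomial_functions.const)
  then show ?thesis
    by (auto simp: topspace_def openin_zariski)
qed

lemma closedin_zariski:
  "closedin (zariski s W) C \<longleftrightarrow>
     (\<exists>P\<subseteq>polynomial_functions s. C = {x \<in> W. \<forall>p\<in>P. p x = 0})"
proof
  assume "closedin (zariski s W) C"
  then obtain P where "C \<subseteq> W" "P \<subseteq> polynomial_functions s"
      "W - C = W - {x \<in> W. \<forall>p\<in>P. p x = 0}"
    unfolding closedin_def openin_zariski by auto
  moreover from this have "C = {x \<in> W. \<forall>p\<in>P. p x = 0}"
    by (metis (no_types, lifting) double_diff mem_Collect_eq subset_refl subsetI)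
  ultimately show "\<exists>P\<subseteq>polynomial_functions s. C = {x \<in> W. \<forall>p\<in>P. p x = 0}"
    by blast
next
  assume "\<exists>P\<subseteq>polynomial_functions s. C = {x \<in> W. \<forall>p\<in>P. p x = 0}"
  then show "closedin (zariski s W) C"
    unfolding closedin_def openin_zariski by auto
qed

definition constructible_in :: "'a topology \<Rightarrow> 'a set \<Rightarrow> bool" where
  "constructible_in X S \<longleftrightarrow>
     (\<exists>\<F>. finite \<F> \<and> (\<forall>L\<in>\<F>. \<exists>U C. openin X U \<and> closedin X C \<and> L = U \<inter> C) \<and> S = \<Union>\<F>)"


subsection \<open>Border subrank\<close>

text \<open>The space \<open>K\<^sup>r\<close>, as functions vanishing outside \<open>{1..r}\<close>.\<close>

definition coord_space :: "nat \<Rightarrow> (nat \<Rightarrow> 'k::field) set" where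
  "coord_space r = {x. \<forall>i. i \<notin> {1..r} \<longrightarrow> x i = 0}"

definition unit_vec :: "nat \<Rightarrow> nat \<Rightarrow> 'k::field" where
  "unit_vec i = (\<lambda>j. if j = i then 1 else 0)"

definition unit_tensor :: "nat \<Rightarrow> nat \<Rightarrow> (nat \<Rightarrow> (nat \<Rightarrow> 'k::field) \<Rightarrow> 'k) \<Rightarrow> 'k" where
  "unit_tensor d r = (\<Sum>i=1..r. pure_tensor fscale d (\<lambda>_. unit_vec i))"

definition degenerations ::
    "('k::field \<Rightarrow> 'v::ab_group_add \<Rightarrow> 'v) \<Rightarrow> nat \<Rightarrow> (nat \<Rightarrow> 'v set) \<Rightarrow> nat \<Rightarrow>
     ((nat \<Rightarrow> 'v \<Rightarrow> 'k) \<Rightarrow> 'k) \<Rightarrow> ((nat \<Rightarrow> (nat \<Rightarrow> 'k) \<Rightarrow> 'k) \<Rightarrow> 'k) set" where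
  "degenerations s d V r T =
     zariski fscale (tensor_space fscale d (\<lambda>_. coord_space r)) closure_of
       {tensor_map fscale d \<phi> T | \<phi>.
          \<forall>i\<in>{1..d}. Vector_Spaces.linear s fscale (\<phi> i) \<and> \<phi> i ` V i \<subseteq> coord_space r}"

text \<open>
  The maximum exists for \<open>d \<ge> 2\<close> and finite-dimensional \<open>V i\<close>: the flattening rank of \<open>T\<close> bounds
  \<open>r\<close>, and \<open>r = 0\<close> always qualifies.
\<close>

definition border_subrank ::
    "('k::field \<Rightarrow> 'v::ab_group_add \<Rightarrow> 'v) \<Rightarrow> nat \<Rightarrow> (nat \<Rightarrow> 'v set) \<Rightarrow>
     ((nat \<Rightarrow> 'v \<Rightarrow> 'k) \<Rightarrow> 'k) \<Rightarrow> nat" where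
  "border_subrank s d V T = (GREATEST r. unit_tensor d r \<in> degenerations s d V r T)"

end

theory Submission
  imports Defs "HOL-Library.Poly_Mapping" "HOL-Combinatorics.Permutations"
begin

text \<open>
  The coordinates of \<open>(\<phi> 1 \<otimes> \<dots> \<otimes> \<phi> d) T\<close> are polynomials in the matrix entries \<open>x\<close> of the
  \<open>\<phi> i\<close>, with coefficients depending linearly on \<open>T\<close>. The unit tensor lies outside the closure of
  the image iff some polynomial in the target coordinates that belongs to the ideal of the graph of
  this map does not vanish at it. This elimination is carried out uniformly in \<open>T\<close>: Buchberger's
  algorithm is run on polynomials with parametric coefficients, branching on whether a leading
  coefficient vanishes. By Dickson's lemma the tree is finite, so the parameter space splits into
  finitely many constructible pieces on each of which one has a Groebner basis of fixed shape, and
  the elimination condition becomes the nonvanishing of finitely many polynomial functions of \<open>T\<close>.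
  Hence for each \<open>r\<close> the tensors degenerating to the unit tensor of size \<open>r\<close> form a constructible set.
  A minor of the flattening along the first factor bounds \<open>r\<close> by the dimension of \<open>V 1\<close>, and the
  theorem follows by finite Boolean combinations.
\<close>

subsection \<open>Polynomials\<close>

text \<open>For a single \<open>T\<close>, elimination theory already describes the closure of the
  image; the obstacle is uniformity. The separating polynomial may depend on \<open>T\<close>, and
  no bound on its degree is at hand, so its existence is not visibly a finite condition on the
  coordinates of \<open>T\<close>. A Groebner basis of fixed shape removes this obstacle: only its
  finitely many members free of source variables have to be tested at the unit tensor. Computations
  with families avoid division, since a quotient of polynomial functions of \<open>T\<close> would
  leave the class of polynomial functions. Algebraic closedness enters through the infinitude of the
  field, which makes the graph equations generate every polynomial that vanishes on the
  graph.\<close>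

abbreviation "lookup \<equiv> poly_mapping.lookup"
abbreviation "keys \<equiv> Poly_Mapping.keys"
abbreviation "single \<equiv> Poly_Mapping.single"

type_synonym mon = "nat \<Rightarrow>\<^sub>0 nat"
type_synonym 'k mpol = "mon \<Rightarrow>\<^sub>0 'k"

lemma lookup_single_mult_add [simp]:
  fixes a u :: "'m::cancel_comm_monoid_add" and c :: "'k::semiring_0"
  shows "lookup (single a c * g) (a + u) = c * lookup g u"
proof -
  have "(\<lambda>l. lookup (single a c) l * (\<Sum>q. lookup g q when a + u = l + q)) =
      (\<lambda>l. (c * (\<Sum>q. lookup g q when a + u = l + q)) when l = a)"
    by (auto simp: fun_eq_iff lookup_single when_def)
  then show ?thesis
    unfolding lookup_mult by (simp only: Sum_any_when_equal) simp
qed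

lemma keys_single_mult:
  fixes a :: "'m::cancel_comm_monoid_add" and c :: "'k::semiring_0"
  shows "keys (single a c * g) \<subseteq> (+) a ` keys g"
  using keys_mult[of "single a c" g] by (auto split: if_splits)

lemma lookup_single_mult_notin:
  fixes a :: "'m::cancel_comm_monoid_add" and c :: "'k::semiring_0"
  shows "w \<notin> range ((+) a) \<Longrightarrow> lookup (single a c * g) w = 0"
  using keys_single_mult[of a c g] by (force simp: in_keys_iff)

lemma lookup_single_0_mult [simp]:
  fixes u :: "'m::cancel_comm_monoid_add" and c :: "'k::semiring_0"
  shows "lookup (single 0 c * g) u = c * lookup g u"
  using lookup_single_mult_add[of 0 c g u] by simp

lemma poly_mapping_sum_single: "f = (\<Sum>u\<in>keys f. single u (lookup f u))"
  by (rule poly_mapping_eqI)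
    (auto simp: lookup_sum lookup_single when_def sum.delta' in_keys_iff)


subsection \<open>Evaluation\<close>

definition mon_eval :: "(nat \<Rightarrow> 'k::comm_semiring_1) \<Rightarrow> mon \<Rightarrow> 'k" where
  "mon_eval y u = (\<Prod>i\<in>keys u. y i ^ lookup u i)"

definition mpoly_eval :: "(nat \<Rightarrow> 'k::comm_ring_1) \<Rightarrow> 'k mpol \<Rightarrow> 'k" where
  "mpoly_eval y f = (\<Sum>u\<in>keys f. lookup f u * mon_eval y u)"

lemma mon_eval_superset: "finite I \<Longrightarrow> keys u \<subseteq> I \<Longrightarrow> mon_eval y u = (\<Prod>i\<in>I. y i ^ lookup u i)"
  unfolding mon_eval_def by (rule prod.mono_neutral_left) (auto simp: in_keys_iff)

lemma mon_eval_add: "mon_eval y (a + u) = mon_eval y a * mon_eval y u"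
proof -
  have "keys (a + u) \<subseteq> keys a \<union> keys u" by (rule keys_add)
  then show ?thesis
    using mon_eval_superset[of "keys a \<union> keys u" _ y]
    by (simp add: lookup_add power_add prod.distrib)
qed

lemma mon_eval_0 [simp]: "mon_eval y 0 = 1"
  by (simp add: mon_eval_def)

lemma mon_eval_single [simp]: "mon_eval y (single i k) = y i ^ k"
  by (simp add: mon_eval_def)

lemma mon_eval_cong: "(\<And>i. i \<in> keys u \<Longrightarrow> y i = y' i) \<Longrightarrow> mon_eval y u = mon_eval y' u"
  unfolding mon_eval_def by (rule prod.cong) auto

lemma mpoly_eval_superset: "finite A \<Longrightarrow> keys f \<subseteq> A \<Longrightarrow> mpoly_eval y f = (\<Sum>u\<in>A. lookup f u * mon_eval y u)"
  unfolding mpoly_eval_def by (rule sum.mono_neutral_left) (auto simp: in_keys_iff)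

lemma mpoly_eval_cong: "(\<And>u i. u \<in> keys f \<Longrightarrow> i \<in> keys u \<Longrightarrow> y i = y' i) \<Longrightarrow> mpoly_eval y f = mpoly_eval y' f"
  unfolding mpoly_eval_def by (intro sum.cong arg_cong2[where f="(*)"] mon_eval_cong) auto

lemma mpoly_eval_0 [simp]: "mpoly_eval y 0 = 0"
  by (simp add: mpoly_eval_def)

lemma mpoly_eval_add: "mpoly_eval y (f + g) = mpoly_eval y f + mpoly_eval y g"
proof -
  have "keys (f + g) \<subseteq> keys f \<union> keys g" by (rule keys_add)
  then show ?thesis
    using mpoly_eval_superset[of "keys f \<union> keys g" _ y]
    by (simp add: lookup_add algebra_simps sum.distrib)
qed

lemma mpoly_eval_diff: "mpoly_eval y (f - g) = mpoly_eval y f - mpoly_eval y g"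
  using mpoly_eval_add[of y "f - g" g] by simp

lemma mpoly_eval_sum: "mpoly_eval y (sum f I) = (\<Sum>i\<in>I. mpoly_eval y (f i))"
  by (induction I rule: infinite_finite_induct) (auto simp: mpoly_eval_add)

lemma mpoly_eval_single [simp]: "mpoly_eval y (single u c) = c * mon_eval y u"
  by (simp add: mpoly_eval_def)

lemma mpoly_eval_single_mult: "mpoly_eval y (single a c * g) = c * mon_eval y a * mpoly_eval y g"
proof -
  have "mpoly_eval y (single a c * g) = (\<Sum>w\<in>(+) a ` keys g. lookup (single a c * g) w * mon_eval y w)"
    by (rule mpoly_eval_superset) (auto intro!: keys_single_mult)
  also have "\<dots> = (\<Sum>u\<in>keys g. lookup (single a c * g) (a + u) * mon_eval y (a + u))"
    by (subst sum.reindex) auto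
  also have "\<dots> = c * mon_eval y a * mpoly_eval y g"
    by (simp only: lookup_single_mult_add mon_eval_add mpoly_eval_def sum_distrib_left) (simp add: ac_simps)
  finally show ?thesis .
qed

lemma mpoly_eval_mult: "mpoly_eval y (f * g) = mpoly_eval y f * mpoly_eval y g"
proof -
  have "f * g = (\<Sum>u\<in>keys f. single u (lookup f u) * g)"
    by (subst (1) poly_mapping_sum_single[of f]) (simp only: sum_distrib_right)
  then have "mpoly_eval y (f * g) = (\<Sum>u\<in>keys f. lookup f u * mon_eval y u * mpoly_eval y g)"
    by (simp add: mpoly_eval_sum mpoly_eval_single_mult)
  then show ?thesis by (simp add: mpoly_eval_def sum_distrib_right)
qed


subsection \<open>Monomials\<close>

text \<open>
  The order on exponent vectors \<open>nat \<Rightarrow>\<^sub>0 nat\<close> is the lexicographic one of \<open>Poly_Mapping\<close>, in which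
  the variable with the smallest index is the largest.
\<close>

definition Mon :: "nat \<Rightarrow> mon set" where
  "Mon N = {u. keys u \<subseteq> {..<N}}"

lemma keys_add_nat: "keys (a + u) = keys a \<union> keys (u :: mon)"
  by (auto simp: in_keys_iff lookup_add)

lemma Mon_add_iff [simp]: "a + u \<in> Mon N \<longleftrightarrow> a \<in> Mon N \<and> u \<in> Mon N"
  by (simp add: Mon_def keys_add_nat)

lemma Mon_0 [simp]: "0 \<in> Mon N"
  by (simp add: Mon_def)

lemma Mon_mono: "n \<le> N \<Longrightarrow> Mon n \<subseteq> Mon N"
  by (force simp: Mon_def)

lemma less_mon_iff:
  "u < (v::mon) \<longleftrightarrow> (\<exists>k. lookup u k < lookup v k \<and> (\<forall>k'<k. lookup u k' = lookup v k'))"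
  by transfer (simp add: less_fun_def)

text \<open>In infinitely many variables the lexicographic order has the descending chain of the
  variables themselves. With \<open>N\<close> variables an exponent vector becomes a list of fixed
  length, and \<open>lex\<close> on lists of equal length is well-founded.\<close>

lemma wf_Mon: "wf {(u, v). u \<in> Mon N \<and> v \<in> Mon N \<and> u < v}"
proof (rule wf_subset)
  show "wf (inv_image (lex less_than) (\<lambda>u. map (lookup u) [0..<N]))"
    by (intro wf_inv_image wf_lex) simp
  show "{(u, v). u \<in> Mon N \<and> v \<in> Mon N \<and> u < v} \<subseteq>
      inv_image (lex less_than) (\<lambda>u. map (lookup u) [0..<N])"
  proof clarsimp
    fix u v :: mon assume uv: "u \<in> Mon N" "v \<in> Mon N" "u < v"
    then obtain k where k: "lookup u k < lookup v k" "\<forall>k'<k. lookup u k' = lookup v k'"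
      by (auto simp: less_mon_iff)
    then have "k \<in> keys v" by (simp add: in_keys_iff)
    then have "k < N" using uv by (auto simp: Mon_def)
    then have split: "[0..<N] = [0..<k] @ k # [Suc k..<N]"
      using upt_add_eq_append[of 0 k "N - k"] upt_conv_Cons[of k N] by simp
    show "(map (lookup u) [0..<N], map (lookup v) [0..<N]) \<in> lex less_than"
    proof -
      have "map (lookup u) [0..<k] = map (lookup v) [0..<k]" using k(2) by simp
      then have "map (lookup u) [0..<N] =
          map (lookup v) [0..<k] @ lookup u k # map (lookup u) [Suc k..<N]"
        unfolding split map_append list.map by (rule arg_cong2[where f="(@)"]) (rule refl)
      moreover have "map (lookup v) [0..<N] =
          map (lookup v) [0..<k] @ lookup v k # map (lookup v) [Suc k..<N]"
        unfolding split map_append list.map by (rule refl)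
      moreover have "(lookup u k # map (lookup u) [Suc k..<N], lookup v k # map (lookup v) [Suc k..<N])
          \<in> lex less_than"
        using k(1) by (simp del: upt_Suc)
      ultimately show ?thesis by (metis lex_append_leftI)
    qed
  qed
qed

text \<open>Subtraction of exponents is truncated, so \<open>u + (v - u)\<close> is the exponentwise
  maximum, that is, the least common multiple.\<close>

definition mlcm :: "mon \<Rightarrow> mon \<Rightarrow> mon" where
  "mlcm u v = u + (v - u)"

lemma lookup_minus_nat: "lookup (u - v) i = lookup u i - lookup (v::mon) i"
  by (simp add: lookup_minus)

lemma mlcm_commute: "mlcm u v = mlcm v u"
  unfolding mlcm_def by (rule poly_mapping_eqI) (simp add: lookup_add lookup_minus_nat)

text \<open>A common multiple of \<open>u\<close> and \<open>v\<close> is the least one times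
  \<open>a - (v - u)\<close>; the other two equations factor the cofactors \<open>a\<close> and
  \<open>b\<close> through those used in the S-polynomial.\<close>

lemma mlcm_dvd:
  assumes "a + u = b + v"
  shows "a + u = (a - (v - u)) + mlcm u v" "a = (a - (v - u)) + (v - u)"
    "b = (a - (v - u)) + (u - v)"
proof -
  have l: "lookup a i + lookup u i = lookup b i + lookup v i" for i
    using arg_cong[OF assms, of "\<lambda>w. lookup w i"] by (simp add: lookup_add)
  have n: "x = (x - (q - p)) + (q - p)" "y = (x - (q - p)) + (p - q)"
    if "x + p = y + q" for x y p q :: nat
    using that by (cases p q rule: le_cases; simp)+
  show a: "a = (a - (v - u)) + (v - u)"
    by (rule poly_mapping_eqI, unfold lookup_add lookup_minus_nat, rule n(1)[OF l])
  show "b = (a - (v - u)) + (u - v)"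
    by (rule poly_mapping_eqI, unfold lookup_add lookup_minus_nat, rule n(2)[OF l])
  have "mlcm u v = (v - u) + u"
    by (simp add: mlcm_def add.commute)
  then show "a + u = (a - (v - u)) + mlcm u v"
    using a by (metis add.assoc)
qed

lemma minus_Mon: "u \<in> Mon N \<Longrightarrow> u - v \<in> Mon N"
  by (auto simp: Mon_def in_keys_iff lookup_minus_nat subset_iff)


subsection \<open>Dickson's lemma\<close>

text \<open>A decreasing sequence of naturals attains its least value and is constant from there on,
  hence nondecreasing after a shift.\<close>

lemma nat_seq_mono_subseq:
  fixes s :: "nat \<Rightarrow> nat"
  shows "\<exists>f. strict_mono f \<and> incseq (\<lambda>n. s (f n))"
proof -
  obtain f where f: "strict_mono f" "monoseq (\<lambda>n. s (f n))"
    using seq_monosub by blast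
  show ?thesis
  proof (cases "incseq (\<lambda>n. s (f n))")
    case False
    then have dec: "decseq (\<lambda>n. s (f n))" using f(2) by (simp add: monoseq_iff)
    define m where "m = (LEAST x. \<exists>n. s (f n) = x)"
    obtain n0 where n0: "s (f n0) = m"
      using LeastI_ex[of "\<lambda>x. \<exists>n. s (f n) = x"] unfolding m_def by blast
    have le: "m \<le> s (f n)" for n unfolding m_def by (rule Least_le) blast
    have "s (f (n + n0)) = m" for n
      using le[of "n + n0"] decseqD[OF dec, of n0 "n + n0"] n0 by simp
    then have "incseq (\<lambda>n. s (f (n + n0)))" by (simp add: incseq_def)
    moreover have "strict_mono (\<lambda>n. f (n + n0))"
      using f(1) by (simp add: strict_mono_def)
    ultimately show ?thesis by blast
  qed (use f in blast)
qed

lemma dickson_subseq: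
  fixes s :: "nat \<Rightarrow> nat \<Rightarrow> nat"
  shows "\<exists>f. strict_mono f \<and> (\<forall>k<N. incseq (\<lambda>n. s (f n) k))"
proof (induction N)
  case 0
  show ?case by (intro exI[of _ id]) (simp add: strict_mono_def)
next
  case (Suc N)
  then obtain f where f: "strict_mono f" "\<forall>k<N. incseq (\<lambda>n. s (f n) k)" by blast
  obtain g where g: "strict_mono g" "incseq (\<lambda>n. s (f (g n)) N)"
    using nat_seq_mono_subseq[of "\<lambda>n. s (f n) N"] by blast
  have "strict_mono (\<lambda>n. f (g n))"
    using f(1) g(1) by (simp add: strict_mono_def)
  moreover have "incseq (\<lambda>n. s (f (g n)) k)" if "k < N" for k
    using f(2) that g(1) by (simp add: incseq_def strict_mono_leD)
  ultimately show ?case using g(2) by (intro exI[of _ "\<lambda>n. f (g n)"]) (auto simp: less_Suc_eq)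
qed

lemma dickson:
  fixes s :: "nat \<Rightarrow> mon"
  assumes "\<And>n. s n \<in> Mon N"
  shows "\<exists>i j a. i < j \<and> s j = a + s i"
proof -
  obtain f where f: "strict_mono f" "\<forall>k<N. incseq (\<lambda>n. lookup (s (f n)) k)"
    using dickson_subseq[of N "\<lambda>n. lookup (s n)"] by blast
  have "lookup (s (f 0)) k \<le> lookup (s (f 1)) k" for k
  proof (cases "k < N")
    case True
    then show ?thesis using f(2) by (auto simp: incseq_def)
  next
    case False
    then have "k \<notin> keys (s (f 0))" using assms[of "f 0"] by (auto simp: Mon_def)
    then show ?thesis by (simp add: in_keys_iff)
  qed
  then have "s (f 1) = (s (f 1) - s (f 0)) + s (f 0)"
    by (intro poly_mapping_eqI) (simp add: lookup_add lookup_minus_nat)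
  moreover have "f 0 < f 1" using f(1) by (simp add: strict_mono_def)
  ultimately show ?thesis by blast
qed

text \<open>The termination order of the parametric Buchberger algorithm. Along an infinite chain
  the sets grow, so no new monomial would be a multiple of an earlier one, against Dickson's
  lemma.\<close>

lemma wf_new_monomial:
  "wf {(E', E). \<exists>u\<in>Mon N. E' = insert u E \<and> (\<forall>e\<in>E. \<forall>a. u \<noteq> a + e)}"
proof (subst wf_iff_no_infinite_down_chain, rule notI, elim exE)
  fix E assume "\<forall>i. (E (Suc i), E i) \<in> {(E', E). \<exists>u\<in>Mon N. E' = insert u E \<and> (\<forall>e\<in>E. \<forall>a. u \<noteq> a + e)}"
  then have "\<forall>i. \<exists>u. u \<in> Mon N \<and> E (Suc i) = insert u (E i) \<and> (\<forall>e\<in>E i. \<forall>a. u \<noteq> a + e)"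
    by blast
  then obtain u where u: "\<And>i. u i \<in> Mon N" "\<And>i. E (Suc i) = insert (u i) (E i)"
    "\<And>i e a. e \<in> E i \<Longrightarrow> u i \<noteq> a + e"
    by metis
  obtain i j a where ij: "i < j" "u j = a + u i" using dickson[of u N] u(1) by blast
  have "E (Suc i) \<subseteq> E j"
    by (rule lift_Suc_mono_le) (use u(2) ij(1) in auto)
  then have "u i \<in> E j" using u(2)[of i] by blast
  then show False using u(3)[of "u i" j a] ij(2) by blast
qed


subsection \<open>Standard representations and Buchberger's criterion\<close>

text \<open>
  \<open>G\<close> consists of polynomials paired with their intended leading monomials; the predicate \<open>Q\<close>
  constrains the leading monomials of the multiples that may be used.
\<close>

inductive_set Span :: "nat \<Rightarrow> (mon \<times> 'k::comm_ring_1 mpol) set \<Rightarrow> (mon \<Rightarrow> bool) \<Rightarrow> 'k mpol set"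
  for N G Q where
  zero: "0 \<in> Span N G Q"
| step: "p \<in> Span N G Q \<Longrightarrow> (u, g) \<in> G \<Longrightarrow> a \<in> Mon N \<Longrightarrow> Q (a + u) \<Longrightarrow>
    p + single a c * g \<in> Span N G Q"

lemma Span_base: "(u, g) \<in> G \<Longrightarrow> a \<in> Mon N \<Longrightarrow> Q (a + u) \<Longrightarrow> single a c * g \<in> Span N G Q"
  using Span.step[OF Span.zero] by simp

lemma Span_add:
  assumes "p \<in> Span N G Q" "q \<in> Span N G Q"
  shows "p + q \<in> Span N G Q"
  using assms(2)
proof induction
  case (step q u g a c)
  then have "(p + q) + single a c * g \<in> Span N G Q" by (intro Span.step)
  then show ?case by (simp add: add.assoc)
qed (simp add: assms)

lemma Span_single_mult:
  assumes "p \<in> Span N G Q" "a \<in> Mon N" "\<And>v. Q v \<Longrightarrow> Q' (a + v)"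
  shows "single a c * p \<in> Span N G Q'"
  using assms(1)
proof induction
  case (step p u g b d)
  have "single a c * p + single (a + b) (c * d) * g \<in> Span N G Q'"
    using step assms(2) assms(3)[of "b + u"] by (intro Span.step) (auto simp: add.assoc)
  then show ?case by (simp add: ring_distribs mult_single flip: mult.assoc)
qed (simp add: Span.zero)

lemma Span_scale: "p \<in> Span N G Q \<Longrightarrow> single 0 c * p \<in> Span N G Q"
  by (rule Span_single_mult) auto

lemma Span_uminus: "p \<in> Span N G Q \<Longrightarrow> - p \<in> Span N G Q"
  using Span_scale[of p N G Q "-1"] by (simp add: single_uminus)

lemma Span_diff: "p \<in> Span N G Q \<Longrightarrow> q \<in> Span N G Q \<Longrightarrow> p - q \<in> Span N G Q"
  using Span_add[OF _ Span_uminus, of p N G Q q] by simp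

lemma Span_scaleD:
  fixes c :: "'k::field"
  assumes "single 0 c * p \<in> Span N G Q" "c \<noteq> 0"
  shows "p \<in> Span N G Q"
  using Span_scale[OF assms(1), of "inverse c"] assms(2)
  by (simp add: mult_single flip: mult.assoc)

lemma Span_subset:
  assumes "p \<in> Span N G Q"
    and "\<And>u g a. (u, g) \<in> G \<Longrightarrow> a \<in> Mon N \<Longrightarrow> Q (a + u) \<Longrightarrow> single a 1 * g \<in> Span N G' Q'"
  shows "p \<in> Span N G' Q'"
  using assms(1)
proof induction
  case (step p u g a c)
  have "single 0 c * (single a 1 * g) \<in> Span N G' Q'"
    using step assms(2) by (intro Span_scale) auto
  then have "single a c * g \<in> Span N G' Q'"
    by (simp add: mult_single flip: mult.assoc)
  then show ?case using step Span_add by blast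
qed (simp add: Span.zero)

lemma Span_mono:
  assumes "p \<in> Span N G Q"
    and "\<And>u g a. (u, g) \<in> G \<Longrightarrow> a \<in> Mon N \<Longrightarrow> Q (a + u) \<Longrightarrow> (u, g) \<in> G' \<and> Q' (a + u)"
  shows "p \<in> Span N G' Q'"
  using assms by (blast intro: Span_subset Span_base)

lemma Span_mult:
  assumes "p \<in> Span N G (\<lambda>_. True)" "keys q \<subseteq> Mon N"
  shows "q * p \<in> Span N G (\<lambda>_. True)"
proof -
  have "(\<Sum>u\<in>K. single u (lookup q u) * p) \<in> Span N G (\<lambda>_. True)"
    if "finite K" "K \<subseteq> Mon N" for K
    using that by (induction rule: finite_induct)
      (auto intro!: Span.zero Span_add Span_single_mult[OF assms(1)])
  then have "(\<Sum>u\<in>keys q. single u (lookup q u)) * p \<in> Span N G (\<lambda>_. True)"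
    using assms(2) by (simp only: sum_distrib_right finite_keys)
  then show ?thesis by (simp flip: poly_mapping_sum_single)
qed

text \<open>Only finitely many multiples occur in a representation. The largest of their leading
  monomials satisfies \<open>Q\<close> and bounds the others; \<open>p \<noteq> 0\<close> guarantees
  that there is at least one. The induction in \<open>groebner\<close> runs on this bound.\<close>

lemma Span_bounded:
  assumes "p \<in> Span N G Q" "p \<noteq> 0"
    and "\<And>u g. (u, g) \<in> G \<Longrightarrow> u \<in> Mon N"
  shows "\<exists>v\<in>Mon N. Q v \<and> p \<in> Span N G (\<lambda>w. w \<le> v)"
proof -
  have "p = 0 \<or> (\<exists>v\<in>Mon N. Q v \<and> p \<in> Span N G (\<lambda>w. w \<le> v))"
    using assms(1)
  proof induction
    case (step p u g a c)
    have m: "a + u \<in> Mon N" using step assms(3) by simp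
    from step.IH show ?case
    proof
      assume "p = 0"
      moreover have "single a c * g \<in> Span N G (\<lambda>w. w \<le> a + u)"
        using step by (intro Span_base) auto
      ultimately show ?thesis using m step by auto
    next
      assume "\<exists>v\<in>Mon N. Q v \<and> p \<in> Span N G (\<lambda>w. w \<le> v)"
      then obtain v where v: "v \<in> Mon N" "Q v" "p \<in> Span N G (\<lambda>w. w \<le> v)" by blast
      define z where "z = max v (a + u)"
      have "p \<in> Span N G (\<lambda>w. w \<le> z)"
        by (rule Span_mono[OF v(3)]) (auto simp: z_def max_def)
      then have "p + single a c * g \<in> Span N G (\<lambda>w. w \<le> z)"
        using step by (intro Span.step) (auto simp: z_def)
      moreover have "z \<in> Mon N" "Q z" using v m step by (auto simp: z_def max_def)
      ultimately show ?thesis by blast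
    qed
  qed simp
  then show ?thesis using assms(2) by simp
qed

text \<open>Crosswise multiplication by the leading coefficients replaces the usual division by
  them, so the S-polynomial of two families again has polynomial functions of the parameter as
  coefficients.\<close>

definition spoly :: "mon \<Rightarrow> 'k::comm_ring_1 mpol \<Rightarrow> mon \<Rightarrow> 'k mpol \<Rightarrow> 'k mpol" where
  "spoly u g u' g' =
     single (u' - u) (lookup g' u') * g - single (u - u') (lookup g u) * g'"

text \<open>
  All summands with leading monomial \<open>v\<close> are, modulo S-polynomials, multiples of a single one of
  them, whose coefficient must vanish.
\<close>

lemma Span_cancel:
  fixes G :: "(mon \<times> 'k::field mpol) set"
  assumes G: "\<And>u g. (u, g) \<in> G \<Longrightarrow> u \<in> Mon N \<and> keys g \<subseteq> {..u} \<and> lookup g u \<noteq> 0"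
    and S: "\<And>u g u' g'. (u, g) \<in> G \<Longrightarrow> (u', g') \<in> G \<Longrightarrow>
      spoly u g u' g' \<in> Span N G (\<lambda>w. w < mlcm u u')"
    and f: "f \<in> Span N G (\<lambda>w. w \<le> v)" "lookup f v = 0"
  shows "f \<in> Span N G (\<lambda>w. w < v)"
proof (cases "\<exists>u g a. (u, g) \<in> G \<and> a \<in> Mon N \<and> a + u = v")
  case True
  then obtain u0 g0 a0 where g0: "(u0, g0) \<in> G" "a0 \<in> Mon N" "a0 + u0 = v" by blast
  have "\<exists>k. p - single a0 k * g0 \<in> Span N G (\<lambda>w. w < v)"
    if "p \<in> Span N G (\<lambda>w. w \<le> v)" for p
    using that
  proof induction
    case zero
    show ?case by (rule exI[of _ 0]) (simp add: Span.zero)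
  next
    case (step p u g a c)
    then obtain k where k: "p - single a0 k * g0 \<in> Span N G (\<lambda>w. w < v)" by blast
    show ?case
    proof (cases "a + u = v")
      case False
      then have "(p - single a0 k * g0) + single a c * g \<in> Span N G (\<lambda>w. w < v)"
        using step k by (intro Span.step) auto
      then show ?thesis by (intro exI[of _ k]) (simp add: algebra_simps)
    next
      case True
      \<comment> \<open>\<open>v\<close> is a common multiple of \<open>u\<close> and
        \<open>u0\<close>; \<open>e\<close> is its cofactor over the least common multiple.\<close>
      define e where "e = a - (u0 - u)"
      have e: "a + u = e + mlcm u u0" "a = e + (u0 - u)" "a0 = e + (u - u0)"
        using mlcm_dvd[of a u a0 u0] True g0 unfolding e_def by auto
      have eM: "e \<in> Mon N" unfolding e_def using step by (intro minus_Mon)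
      define l where "l = lookup g0 u0"
      have l: "l \<noteq> 0" using G[OF g0(1)] by (simp add: l_def)
      \<comment> \<open>\<open>spoly\<close> multiplies \<open>g\<close> by \<open>l\<close>, the
        leading coefficient of \<open>g0\<close>; the factor \<open>c / l\<close> restores the
        coefficient \<open>c\<close>.\<close>
      have "single e (c / l) * spoly u g u0 g0 \<in> Span N G (\<lambda>w. w < v)"
        using e(1) True by (intro Span_single_mult[OF S[OF step(2) g0(1)] eM]) (auto simp: add_strict_left_mono)
      moreover have "single e (c / l) * spoly u g u0 g0 =
          single a c * g - single a0 (c / l * lookup g u) * g0"
        unfolding spoly_def right_diff_distrib mult.assoc[symmetric] mult_single
        by (simp only: e(2,3)[symmetric]) (use l in \<open>simp add: l_def\<close>)
      ultimately have "(p - single a0 k * g0) + (single a c * g - single a0 (c / l * lookup g u) * g0)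
          \<in> Span N G (\<lambda>w. w < v)"
        using k Span_add by metis
      then show ?thesis
        by (intro exI[of _ "k + c / l * lookup g u"]) (simp add: algebra_simps single_add)
    qed
  qed
  then obtain k where k: "f - single a0 k * g0 \<in> Span N G (\<lambda>w. w < v)" using f(1) by blast
  \<comment> \<open>Multiples with leading monomial below \<open>v\<close> do not contain
    \<open>v\<close>. Comparing coefficients at \<open>v\<close> leaves \<open>k\<close> times the
    leading coefficient of \<open>g0\<close>, so \<open>k = 0\<close>.\<close>
  have "lookup p v = 0" if "p \<in> Span N G (\<lambda>w. w < v)" for p
    using that
  proof induction
    case (step p u g a c)
    have "w < v" if w: "w \<in> keys (single a c * g)" for w
    proof -
      obtain u' where "u' \<in> keys g" "w = a + u'" using w keys_single_mult[of a c g] by blast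
      then have "w \<le> a + u" using G[OF step(2)] by (auto intro: add_left_mono)
      then show ?thesis using step by simp
    qed
    then have "lookup (single a c * g) v = 0" by (force simp: in_keys_iff)
    then show ?case using step by (simp add: lookup_add)
  qed simp
  then have "lookup (f - single a0 k * g0) v = 0" using k by blast
  then have "k * lookup g0 u0 = 0"
    using f(2) g0(3) lookup_single_mult_add[of a0 k g0 u0] by (simp add: lookup_minus)
  then have "k = 0" using G[OF g0(1)] by simp
  then show ?thesis using k by simp
next
  case False
  then show ?thesis using f(1) by (elim Span_mono) (auto simp: order_le_less)
qed

text \<open>While the bound \<open>v\<close> is not a monomial of \<open>f\<close>, the terms at
  \<open>v\<close> cancel and \<open>Span_cancel\<close> yields a smaller bound; well-foundedness
  stops this at a monomial of \<open>f\<close>.\<close>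

lemma groebner:
  fixes G :: "(mon \<times> 'k::field mpol) set"
  assumes G: "\<And>u g. (u, g) \<in> G \<Longrightarrow> u \<in> Mon N \<and> keys g \<subseteq> {..u} \<and> lookup g u \<noteq> 0"
    and S: "\<And>u g u' g'. (u, g) \<in> G \<Longrightarrow> (u', g') \<in> G \<Longrightarrow>
      spoly u g u' g' \<in> Span N G (\<lambda>w. w < mlcm u u')"
    and f: "f \<in> Span N G (\<lambda>_. True)"
  shows "f \<in> Span N G (\<lambda>w. \<exists>v\<in>keys f. w \<le> v)"
proof (cases "f = 0")
  case False
  then obtain v0 where v0: "v0 \<in> Mon N" "f \<in> Span N G (\<lambda>w. w \<le> v0)"
    using Span_bounded[OF f] G by blast
  have "v \<in> Mon N \<Longrightarrow> f \<in> Span N G (\<lambda>w. w \<le> v) \<Longrightarrow> ?thesis" for v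
  proof (induction v rule: wf_induct_rule[OF wf_Mon[of N]])
    case (1 v)
    show ?case
    proof (cases "v \<in> keys f")
      case True
      then show ?thesis using 1(3) by (elim Span_mono) auto
    next
      case nk: False
      then have "f \<in> Span N G (\<lambda>w. w < v)"
        using Span_cancel[OF G S 1(3)] by (simp add: in_keys_iff)
      then obtain v' where "v' \<in> Mon N" "v' < v" "f \<in> Span N G (\<lambda>w. w \<le> v')"
        using Span_bounded[of f N G "\<lambda>w. w < v"] False G by blast
      then show ?thesis using 1(1)[of v'] 1(2) by blast
    qed
  qed
  then show ?thesis using v0 by blast
qed (simp add: Span.zero)


subsection \<open>Constructible sets\<close>

lemma constructible_in_locally_closed:
  "openin X U \<Longrightarrow> closedin X C \<Longrightarrow> constructible_in X (U \<inter> C)"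
  unfolding constructible_in_def by (intro exI[of _ "{U \<inter> C}"]) auto

lemma constructible_in_empty: "constructible_in X {}"
  unfolding constructible_in_def by (intro exI[of _ "{}"]) auto

lemma constructible_in_openin: "openin X U \<Longrightarrow> constructible_in X U"
  using constructible_in_locally_closed[of X U "topspace X"] openin_subset[of X U]
  by (simp add: Int_absorb2)

lemma constructible_in_topspace: "constructible_in X (topspace X)"
  by (rule constructible_in_openin) simp

lemma constructible_in_closedin: "closedin X C \<Longrightarrow> constructible_in X C"
  using constructible_in_locally_closed[of X "topspace X" C] closedin_subset[of X C]
  by (simp add: Int_absorb1)

lemma constructible_in_subset: "constructible_in X S \<Longrightarrow> S \<subseteq> topspace X"
  unfolding constructible_in_def by (auto dest!: closedin_subset bspec)

lemma constructible_in_Un: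
  assumes "constructible_in X S" "constructible_in X T"
  shows "constructible_in X (S \<union> T)"
proof -
  let ?lc = "\<lambda>L. \<exists>U C. openin X U \<and> closedin X C \<and> L = U \<inter> C"
  obtain F G where "finite F" "\<forall>L\<in>F. ?lc L" "S = \<Union>F" "finite G" "\<forall>L\<in>G. ?lc L" "T = \<Union>G"
    using assms unfolding constructible_in_def by blast
  then show ?thesis
    unfolding constructible_in_def by (intro exI[of _ "F \<union> G"]) blast
qed

lemma constructible_in_UN:
  "finite I \<Longrightarrow> (\<And>i. i \<in> I \<Longrightarrow> constructible_in X (S i)) \<Longrightarrow> constructible_in X (\<Union>i\<in>I. S i)"
  by (induction I rule: finite_induct) (auto intro: constructible_in_Un constructible_in_empty)

lemma constructible_in_Int:
  assumes "constructible_in X S" "constructible_in X T"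
  shows "constructible_in X (S \<inter> T)"
proof -
  let ?lc = "\<lambda>L. \<exists>U C. openin X U \<and> closedin X C \<and> L = U \<inter> C"
  obtain F G where F: "finite F" "\<forall>L\<in>F. ?lc L" "S = \<Union>F" and G: "finite G" "\<forall>L\<in>G. ?lc L" "T = \<Union>G"
    using assms unfolding constructible_in_def by blast
  have "constructible_in X (L \<inter> M)" if L: "L \<in> F" "M \<in> G" for L M
  proof -
    obtain U C where "openin X U" "closedin X C" "L = U \<inter> C"
      using bspec[OF F(2) L(1)] by blast
    moreover obtain U' C' where "openin X U'" "closedin X C'" "M = U' \<inter> C'"
      using bspec[OF G(2) L(2)] by blast
    ultimately show ?thesis
      using constructible_in_locally_closed[of X "U \<inter> U'" "C \<inter> C'"]
      by (simp add: Int_ac openin_Int closedin_Int)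
  qed
  then have "constructible_in X (\<Union>L\<in>F. \<Union>M\<in>G. L \<inter> M)"
    using F(1) G(1) by (intro constructible_in_UN)
  moreover have "(\<Union>L\<in>F. \<Union>M\<in>G. L \<inter> M) = S \<inter> T"
    using F(3) G(3) by blast
  ultimately show ?thesis by simp
qed

text \<open>The complement of a locally closed set is the union of an open and a closed set; a
  finite union is handled by intersecting such complements.\<close>

lemma constructible_in_compl:
  assumes "constructible_in X S"
  shows "constructible_in X (topspace X - S)"
proof -
  obtain F where F: "finite F" "\<forall>L\<in>F. \<exists>U C. openin X U \<and> closedin X C \<and> L = U \<inter> C" "S = \<Union>F"
    using assms unfolding constructible_in_def by blast
  from F(1,2) have "constructible_in X (topspace X - \<Union>F)"
  proof (induction F rule: finite_induct)
    case empty
    then show ?case by (simp add: constructible_in_openin)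
  next
    case (insert L F)
    then obtain U C where "openin X U" "closedin X C" "L = U \<inter> C" by blast
    then have "constructible_in X (topspace X - L)"
      unfolding \<open>L = U \<inter> C\<close> Diff_Int
      by (intro constructible_in_Un constructible_in_openin[OF openin_diff]
          constructible_in_closedin[OF closedin_diff]) auto
    moreover have "topspace X - \<Union>(insert L F) = (topspace X - L) \<inter> (topspace X - \<Union>F)"
      by blast
    ultimately show ?case using insert constructible_in_Int by simp
  qed
  then show ?thesis using F(3) by simp
qed

lemma constructible_in_Diff:
  assumes "constructible_in X S" "constructible_in X T"
  shows "constructible_in X (S - T)"
proof -
  have "S - T = S \<inter> (topspace X - T)"
    using constructible_in_subset[OF assms(1)] by blast
  then show ?thesis
    using constructible_in_Int[OF assms(1) constructible_in_compl[OF assms(2)]] by simp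
qed

lemma constructible_zariski_eq_0:
  assumes "constructible_in (zariski s W) S" "p \<in> polynomial_functions s"
  shows "constructible_in (zariski s W) {T \<in> S. p T = 0}"
proof -
  have "closedin (zariski s W) {T \<in> W. p T = 0}"
    unfolding closedin_zariski using assms(2) by (intro exI[of _ "{p}"]) auto
  moreover have "{T \<in> S. p T = 0} = S \<inter> {T \<in> W. p T = 0}"
    using constructible_in_subset[OF assms(1)] by auto
  ultimately show ?thesis
    using constructible_in_Int assms(1) constructible_in_closedin by metis
qed

lemma constructible_zariski_neq_0:
  assumes "constructible_in (zariski s W) S" "p \<in> polynomial_functions s"
  shows "constructible_in (zariski s W) {T \<in> S. p T \<noteq> 0}"
proof -
  have "{T \<in> S. p T \<noteq> 0} = S - {T \<in> S. p T = 0}" by auto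
  then show ?thesis
    using constructible_in_Diff[OF assms(1) constructible_zariski_eq_0[OF assms]] by simp
qed

lemma constructible_zariski_all_eq_0:
  assumes "constructible_in (zariski s W) S" "finite P" "P \<subseteq> polynomial_functions s"
  shows "constructible_in (zariski s W) {T \<in> S. \<forall>p\<in>P. p T = 0}"
  using assms(2,3)
proof (induction P rule: finite_induct)
  case (insert p P)
  then have "constructible_in (zariski s W) {T \<in> {T \<in> S. \<forall>p\<in>P. p T = 0}. p T = 0}"
    by (intro constructible_zariski_eq_0) auto
  then show ?case by (rule back_subst) auto
qed (simp add: assms)

lemma polynomial_functions_diff:
  assumes "p \<in> polynomial_functions s" "q \<in> polynomial_functions s"
  shows "(\<lambda>x. p x - q x) \<in> polynomial_functions s"
proof -
  have "(\<lambda>x. p x + (- 1) * q x) \<in> polynomial_functions s"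
    by (intro polynomial_functions.add polynomial_functions.mult polynomial_functions.const assms)
  then show ?thesis by simp
qed

lemma polynomial_functions_sum:
  "(\<And>i. i \<in> I \<Longrightarrow> p i \<in> polynomial_functions s) \<Longrightarrow> (\<lambda>x. \<Sum>i\<in>I. p i x) \<in> polynomial_functions s"
  by (induction I rule: infinite_finite_induct)
    (auto intro: polynomial_functions.const polynomial_functions.add)

lemma polynomial_functions_prod:
  "(\<And>i. i \<in> I \<Longrightarrow> p i \<in> polynomial_functions s) \<Longrightarrow> (\<lambda>x. \<Prod>i\<in>I. p i x) \<in> polynomial_functions s"
  by (induction I rule: infinite_finite_induct)
    (auto intro: polynomial_functions.const polynomial_functions.mult)


subsection \<open>Polynomial families\<close>

text \<open>
  The support is controlled only on \<open>S\<close>, whereas the coefficients are polynomial functions everywhere: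
  splitting \<open>S\<close> shrinks \<open>A\<close> without changing \<open>h\<close>.
\<close>

definition poly_family ::
    "('k::field \<Rightarrow> 'w::ab_group_add \<Rightarrow> 'w) \<Rightarrow> nat \<Rightarrow> 'w set \<Rightarrow> mon set \<Rightarrow> ('w \<Rightarrow> 'k mpol) \<Rightarrow> bool" where
  "poly_family s N S A h \<longleftrightarrow> finite A \<and> A \<subseteq> Mon N \<and> (\<forall>T\<in>S. keys (h T) \<subseteq> A) \<and>
     (\<forall>u. (\<lambda>T. lookup (h T) u) \<in> polynomial_functions s)"

lemma poly_family_subset: "poly_family s N S A h \<Longrightarrow> S' \<subseteq> S \<Longrightarrow> poly_family s N S' A h"
  by (auto simp: poly_family_def)

lemma poly_family_add:
  assumes "poly_family s N S A g" "poly_family s N S B h"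
  shows "poly_family s N S (A \<union> B) (\<lambda>T. g T + h T)"
  unfolding poly_family_def
proof (intro conjI ballI allI)
  fix T assume "T \<in> S"
  then have "keys (g T) \<subseteq> A" "keys (h T) \<subseteq> B" using assms by (auto simp: poly_family_def)
  then show "keys (g T + h T) \<subseteq> A \<union> B" using keys_add[of "g T" "h T"] by blast
next
  fix u show "(\<lambda>T. lookup (g T + h T) u) \<in> polynomial_functions s"
    unfolding lookup_add using assms by (intro polynomial_functions.add) (auto simp: poly_family_def)
qed (use assms in \<open>auto simp: poly_family_def\<close>)

lemma poly_family_diff:
  assumes "poly_family s N S A g" "poly_family s N S B h"
  shows "poly_family s N S (A \<union> B) (\<lambda>T. g T - h T)"
  unfolding poly_family_def
proof (intro conjI ballI allI)
  fix T assume "T \<in> S"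
  then have "keys (g T) \<subseteq> A" "keys (h T) \<subseteq> B" using assms by (auto simp: poly_family_def)
  then show "keys (g T - h T) \<subseteq> A \<union> B"
    using keys_diff[of "g T" "h T"] by blast
next
  fix u show "(\<lambda>T. lookup (g T - h T) u) \<in> polynomial_functions s"
    unfolding lookup_minus using assms by (intro polynomial_functions_diff) (auto simp: poly_family_def)
qed (use assms in \<open>auto simp: poly_family_def\<close>)

lemma poly_family_single_mult:
  assumes "poly_family s N S A h" "a \<in> Mon N" "p \<in> polynomial_functions s"
  shows "poly_family s N S ((+) a ` A) (\<lambda>T. single a (p T) * h T)"
  unfolding poly_family_def
proof (intro conjI ballI allI)
  fix w
  show "(\<lambda>T. lookup (single a (p T) * h T) w) \<in> polynomial_functions s"
  proof (cases "w \<in> range ((+) a)")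
    case True
    then obtain u where "w = a + u" by blast
    then show ?thesis using assms by (auto simp: poly_family_def intro: polynomial_functions.mult)
  next
    case False
    then show ?thesis by (simp add: lookup_single_mult_notin polynomial_functions.const)
  qed
next
  fix T assume "T \<in> S"
  then show "keys (single a (p T) * h T) \<subseteq> (+) a ` A"
    using assms(1) keys_single_mult[of a "p T" "h T"] unfolding poly_family_def by blast
qed (use assms in \<open>auto simp: poly_family_def\<close>)

lemma poly_family_scale:
  "poly_family s N S A h \<Longrightarrow> p \<in> polynomial_functions s \<Longrightarrow> poly_family s N S A (\<lambda>T. single 0 (p T) * h T)"
  using poly_family_single_mult[of s N S A h 0 p] by simp

lemma poly_family_remove:
  "poly_family s N S A h \<Longrightarrow> (\<And>T. T \<in> S \<Longrightarrow> lookup (h T) m = 0) \<Longrightarrow> poly_family s N S (A - {m}) h"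
  unfolding poly_family_def by (auto simp: in_keys_iff)

lemma poly_family_single: "u \<in> Mon N \<Longrightarrow> p \<in> polynomial_functions s \<Longrightarrow> poly_family s N S {u} (\<lambda>T. single u (p T))"
  unfolding poly_family_def lookup_single when_def
proof (intro conjI allI)
  fix w assume "p \<in> polynomial_functions s"
  then show "(\<lambda>T. if u = w then p T else 0) \<in> polynomial_functions s"
    by (cases "u = w") (auto intro: polynomial_functions.const)
qed auto

lemma poly_family_sum:
  "finite I \<Longrightarrow> (\<And>i. i \<in> I \<Longrightarrow> poly_family s N S (A i) (h i)) \<Longrightarrow> poly_family s N S (\<Union>i\<in>I. A i) (\<lambda>T. \<Sum>i\<in>I. h i T)"
proof (induction I rule: finite_induct)
  case empty
  show ?case by (simp add: poly_family_def polynomial_functions.const)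
qed (simp add: poly_family_add)

lemma poly_family_mpoly_eval:
  assumes "poly_family s N S A h"
  shows "\<exists>p\<in>polynomial_functions s. \<forall>T\<in>S. mpoly_eval y (h T) = p T"
proof (rule bexI[of _ "\<lambda>T. \<Sum>w\<in>A. lookup (h T) w * mon_eval y w"])
  show "(\<lambda>T. \<Sum>w\<in>A. lookup (h T) w * mon_eval y w) \<in> polynomial_functions s"
    using assms unfolding poly_family_def
    by (intro polynomial_functions_sum polynomial_functions.mult polynomial_functions.const) auto
  show "\<forall>T\<in>S. mpoly_eval y (h T) = (\<Sum>w\<in>A. lookup (h T) w * mon_eval y w)"
    using assms unfolding poly_family_def by (auto intro: mpoly_eval_superset)
qed

section \<open>Families with constant leading monomials, and pseudo-division by them\<close>

text \<open>The parametric form of the hypothesis on \<open>G\<close> in \<open>groebner\<close>: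
  the leading monomials are the same for all \<open>T \<in> S\<close>, while the leading
  coefficients vary.\<close>

definition leading_family ::
    "('k::field \<Rightarrow> 'w::ab_group_add \<Rightarrow> 'w) \<Rightarrow> nat \<Rightarrow> 'w set \<Rightarrow> (mon \<times> ('w \<Rightarrow> 'k mpol)) set \<Rightarrow> bool" where
  "leading_family s N S G \<longleftrightarrow> finite G \<and>
     (\<forall>(u, g)\<in>G. u \<in> Mon N \<and> (\<exists>A. poly_family s N S A g \<and> A \<subseteq> {..u}) \<and> (\<forall>T\<in>S. lookup (g T) u \<noteq> 0))"

definition specialize :: "(mon \<times> ('w \<Rightarrow> 'k mpol)) set \<Rightarrow> 'w \<Rightarrow> (mon \<times> 'k::zero mpol) set" where
  "specialize G T = (\<lambda>(u, g). (u, g T)) ` G"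

lemma leading_familyD:
  assumes "leading_family s N S G" "(u, g) \<in> G"
  shows "u \<in> Mon N" "\<exists>A. poly_family s N S A g \<and> A \<subseteq> {..u}" "T \<in> S \<Longrightarrow> lookup (g T) u \<noteq> 0"
    "T \<in> S \<Longrightarrow> keys (g T) \<subseteq> {..u}"
proof -
  show "u \<in> Mon N" "\<exists>A. poly_family s N S A g \<and> A \<subseteq> {..u}" "T \<in> S \<Longrightarrow> lookup (g T) u \<noteq> 0"
    using assms unfolding leading_family_def by auto
  then show "T \<in> S \<Longrightarrow> keys (g T) \<subseteq> {..u}"
    unfolding poly_family_def by blast
qed

definition reducible :: "mon set \<Rightarrow> mon \<Rightarrow> bool" where
  "reducible E w \<longleftrightarrow> (\<exists>e\<in>E. \<exists>a. w = a + e)"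

text \<open>
  Pseudo-division: multiplying by leading coefficients, which do not vanish on \<open>S\<close>, avoids
  divisions and case distinctions on \<open>T\<close>.
\<close>

lemma reduce_family_below:
  assumes G: "leading_family s N S G"
  shows "v \<in> Mon N \<Longrightarrow> poly_family s N S A h \<Longrightarrow> \<forall>w\<in>A. reducible (fst ` G) w \<longrightarrow> w < v \<Longrightarrow>
    \<exists>c r B. c \<in> polynomial_functions s \<and> (\<forall>T\<in>S. c T \<noteq> 0) \<and>
      poly_family s N S B r \<and> (\<forall>w\<in>B. \<not> reducible (fst ` G) w) \<and>
      (\<forall>T\<in>S. single 0 (c T) * h T - r T \<in> Span N (specialize G T) (\<lambda>w. \<exists>x\<in>A. w \<le> x))"
proof (induction v arbitrary: A h rule: wf_induct_rule[OF wf_Mon[of N]])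
  case (1 v)
  define R where "R = {w \<in> A. reducible (fst ` G) w}"
  have finA: "finite A" "A \<subseteq> Mon N" using 1(3) by (auto simp: poly_family_def)
  show ?case
  proof (cases "R = {}")
    case True
    then show ?thesis
      using 1(3) by (intro exI[of _ "\<lambda>_. 1"] exI[of _ h] exI[of _ A])
        (auto simp: R_def Span.zero intro: polynomial_functions.const)
  next
    case False
    define m where "m = Max R"
    have "m \<in> R" unfolding m_def using False finA by (intro Max_in) (auto simp: R_def)
    then have m: "m \<in> A" "reducible (fst ` G) m" "m < v" "m \<in> Mon N"
      using 1(4) finA by (auto simp: R_def)
    have m_max: "w \<le> m" if "w \<in> A" "reducible (fst ` G) w" for w
      unfolding m_def using that finA by (intro Max_ge) (auto simp: R_def)
    obtain u g a where ug: "(u, g) \<in> G" "m = a + u"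
      using m(2) unfolding reducible_def by auto
    then have aM: "a \<in> Mon N" using m(4) by simp
    obtain C where C: "poly_family s N S C g" "C \<subseteq> {..u}" using leading_familyD(2)[OF G ug(1)] by blast
    have Ph: "(\<lambda>T. lookup (h T) m) \<in> polynomial_functions s"
      and Pg: "(\<lambda>T. lookup (g T) u) \<in> polynomial_functions s"
      using 1(3) C(1) by (auto simp: poly_family_def)
    \<comment> \<open>Cross-multiplication cancels the coefficient at \<open>m\<close>, the largest
      reducible monomial of the support. What the multiple of \<open>g\<close> adds otherwise lies
      below \<open>m\<close>, so the induction hypothesis applies with \<open>m\<close> as the new
      bound.\<close>
    define h1 where "h1 T = single 0 (lookup (g T) u) * h T - single a (lookup (h T) m) * g T" for T
    define A1 where "A1 = (A \<union> (+) a ` C) - {m}"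
    have "poly_family s N S (A \<union> (+) a ` C) h1"
      unfolding h1_def by (intro poly_family_diff poly_family_scale poly_family_single_mult 1(3) C(1) Ph Pg aM)
    moreover have "lookup (h1 T) m = 0" for T
      unfolding h1_def lookup_minus using ug(2) by simp
    ultimately have f1: "poly_family s N S A1 h1"
      unfolding A1_def by (intro poly_family_remove)
    \<comment> \<open>The support may acquire new monomials, but each lies below some element of
      \<open>A\<close>, so bounds relative to \<open>A1\<close> are bounds relative to
      \<open>A\<close>.\<close>
    have le: "\<exists>y\<in>A. x \<le> y" if x: "x \<in> A1" for x
    proof (cases "x \<in> A")
      case False
      then obtain x' where "x' \<in> C" "x = a + x'" using x by (auto simp: A1_def)
      then have "x \<le> m" using C(2) ug(2) by (auto intro: add_left_mono)
      then show ?thesis using m(1) by blast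
    qed auto
    have "w < m" if w: "w \<in> A1" "reducible (fst ` G) w" for w
    proof (cases "w \<in> A")
      case True
      then show ?thesis using w m_max[of w] by (auto simp: A1_def)
    next
      case False
      then obtain x' where "x' \<in> C" "w = a + x'" using w(1) by (auto simp: A1_def)
      then have "w \<le> m" using C(2) ug(2) by (auto intro: add_left_mono)
      then show ?thesis using w by (auto simp: A1_def)
    qed
    then obtain c r B where IH: "c \<in> polynomial_functions s" "\<forall>T\<in>S. c T \<noteq> 0" "poly_family s N S B r"
      "\<forall>w\<in>B. \<not> reducible (fst ` G) w"
      "\<forall>T\<in>S. single 0 (c T) * h1 T - r T \<in> Span N (specialize G T) (\<lambda>w. \<exists>x\<in>A1. w \<le> x)"
      using 1(1)[of m A1 h1] 1(2) m f1 by blast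
    have "single 0 (c T * lookup (g T) u) * h T - r T \<in> Span N (specialize G T) (\<lambda>w. \<exists>x\<in>A. w \<le> x)"
      if T: "T \<in> S" for T
    proof -
      have "single 0 (c T) * h1 T - r T \<in> Span N (specialize G T) (\<lambda>w. \<exists>x\<in>A. w \<le> x)"
      proof (rule Span_mono[OF IH(5)[rule_format, OF T]])
        fix u' g' a' assume "(u', g') \<in> specialize G T" "\<exists>x\<in>A1. a' + u' \<le> x"
        then show "(u', g') \<in> specialize G T \<and> (\<exists>x\<in>A. a' + u' \<le> x)"
          using le order_trans by blast
      qed
      then have "(single 0 (c T) * h1 T - r T) + single a (c T * lookup (h T) m) * g T
          \<in> Span N (specialize G T) (\<lambda>w. \<exists>x\<in>A. w \<le> x)"
        using ug m(1) aM by (intro Span.step) (force simp: specialize_def)+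
      moreover have "single 0 (c T) * h1 T =
          single 0 (c T * lookup (g T) u) * h T - single a (c T * lookup (h T) m) * g T"
        unfolding h1_def right_diff_distrib mult.assoc[symmetric] mult_single by simp
      ultimately show ?thesis by simp
    qed
    moreover have "(\<lambda>T. c T * lookup (g T) u) \<in> polynomial_functions s"
      using IH(1) Pg by (rule polynomial_functions.mult)
    moreover have "\<forall>T\<in>S. c T * lookup (g T) u \<noteq> 0"
      using IH(2) leading_familyD(3)[OF G ug(1)] by simp
    ultimately show ?thesis
      using IH(3,4) by (intro exI[of _ "\<lambda>T. c T * lookup (g T) u"] exI[of _ r] exI[of _ B]) auto
  qed
qed

lemma reduce_family:
  assumes "leading_family s N S G" "poly_family s N S A h" "N > 0"
  shows "\<exists>r B. poly_family s N S B r \<and> (\<forall>w\<in>B. \<not> reducible (fst ` G) w) \<and>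
      (\<forall>T\<in>S. \<exists>c. c \<noteq> 0 \<and> single 0 c * h T - r T \<in> Span N (specialize G T) (\<lambda>w. \<exists>x\<in>A. w \<le> x))"
proof -
  \<comment> \<open>A monomial strictly above the support, obtained by one extra factor of variable
    0, which is available since \<open>N > 0\<close>; inserting \<open>0\<close> covers an empty
    support.\<close>
  define v where "v = Max (insert 0 A) + single 0 (1::nat)"
  have A: "finite A" "A \<subseteq> Mon N" using assms(2) by (auto simp: poly_family_def)
  have "Max (insert 0 A) \<in> insert 0 A" using A by (intro Max_in) auto
  then have "Max (insert 0 A) \<in> Mon N" using A by auto
  moreover have "single 0 (1::nat) \<in> Mon N" using assms(3) by (simp add: Mon_def)
  ultimately have vM: "v \<in> Mon N" unfolding v_def by simp
  have "(0::mon) < single 0 (1::nat)"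
    unfolding less_mon_iff by (rule exI[of _ 0]) simp
  then have v: "Max (insert 0 A) < v"
    using add_strict_left_mono[of 0 "single 0 (1::nat)" "Max (insert 0 A)"] unfolding v_def by simp
  have "w < v" if "w \<in> A" for w
  proof -
    have "w \<le> Max (insert 0 A)" using A(1) that by (intro Max_ge) auto
    then show ?thesis using v by (rule le_less_trans)
  qed
  then have "\<forall>w\<in>A. reducible (fst ` G) w \<longrightarrow> w < v" by blast
  from reduce_family_below[OF assms(1) vM assms(2) this]
  obtain c r B where "\<forall>T\<in>S. c T \<noteq> 0" and r: "poly_family s N S B r"
    "\<forall>w\<in>B. \<not> reducible (fst ` G) w"
    and "\<forall>T\<in>S. single 0 (c T) * h T - r T \<in> Span N (specialize G T) (\<lambda>w. \<exists>x\<in>A. w \<le> x)"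
    by (elim exE conjE)
  then have "\<forall>T\<in>S. \<exists>c. c \<noteq> 0 \<and> single 0 c * h T - r T \<in> Span N (specialize G T) (\<lambda>w. \<exists>x\<in>A. w \<le> x)"
    by blast
  then show ?thesis using r by (intro exI[of _ r] exI[of _ B] conjI)
qed


subsection \<open>Comprehensive elimination\<close>

text \<open>
  This set is down-closed in the lexicographic order, which therefore eliminates the variables below \<open>n\<close>.
\<close>

definition no_low :: "nat \<Rightarrow> mon set" where
  "no_low n = {u. \<forall>i<n. lookup u i = 0}"

lemma no_low_add [simp]: "a + u \<in> no_low n \<longleftrightarrow> a \<in> no_low n \<and> u \<in> no_low n"
  by (auto simp: no_low_def lookup_add)

lemma no_low_downward:
  assumes "w \<le> v" "v \<in> no_low n"
  shows "w \<in> no_low n"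
proof (cases "w = v")
  case False
  then have "w < v" using assms(1) by simp
  then obtain k where k: "lookup w k < lookup v k" "\<forall>k'<k. lookup w k' = lookup v k'"
    by (auto simp: less_mon_iff)
  then have "\<not> k < n" using assms(2) by (auto simp: no_low_def)
  then show ?thesis using assms(2) k(2) by (simp add: no_low_def)
qed (use assms in simp)

text \<open>The ideal reuses \<open>Span\<close>: the constantly true condition imposes no bound,
  and the generators carry the dummy leading monomial \<open>0\<close>.\<close>

abbreviation ideal :: "nat \<Rightarrow> 'k::comm_ring_1 mpol set \<Rightarrow> 'k mpol set" where
  "ideal N F \<equiv> Span N ((\<lambda>g. (0, g)) ` F) (\<lambda>_. True)"

lemma ideal_base: "g \<in> F \<Longrightarrow> g \<in> ideal N F"
  using Span_base[of 0 g "(\<lambda>g. (0, g)) ` F" 0 N "\<lambda>_. True" 1] by simp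

lemma ideal_subset: "p \<in> ideal N F \<Longrightarrow> F \<subseteq> ideal N F' \<Longrightarrow> p \<in> ideal N F'"
  by (erule Span_subset) (auto intro: Span_single_mult)

lemma Span_ideal:
  assumes "p \<in> Span N G Q" "snd ` G \<subseteq> ideal N F"
  shows "p \<in> ideal N F"
proof (rule Span_subset[OF assms(1)])
  fix u g a assume "(u, g) \<in> G" "a \<in> Mon N"
  then show "single a 1 * g \<in> ideal N F"
    using assms(2) by (intro Span_single_mult[of g]) force+
qed

text \<open>For the ideal of a graph over an infinite field, the members free of the variables below
  \<open>n\<close> are the polynomials vanishing on the image. The condition then says that
  \<open>y\<close>, read in the coordinates from \<open>n\<close> on, lies outside the closure of
  the image.\<close>

definition separates :: "nat \<Rightarrow> nat \<Rightarrow> (nat \<Rightarrow> 'k::comm_ring_1) \<Rightarrow> 'k mpol set \<Rightarrow> bool" where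
  "separates N n y F \<longleftrightarrow> (\<exists>f\<in>ideal N F. keys f \<subseteq> no_low n \<and> mpoly_eval y f \<noteq> 0)"

text \<open>Remainders are adjoined to the generators during the algorithm; they already lie in the
  ideal, so the condition is preserved.\<close>

lemma separates_cong:
  assumes "F \<subseteq> F'" "F' \<subseteq> ideal N F"
  shows "separates N n y F' \<longleftrightarrow> separates N n y F"
proof -
  have "F \<subseteq> ideal N F'" using assms(1) ideal_base by blast
  then show ?thesis unfolding separates_def using assms(2) ideal_subset by metis
qed

text \<open>The elimination property of the order: in a standard representation of an
  \<open>f\<close> without low variables, every multiple has its leading monomial below a monomial
  of \<open>f\<close>, hence in the down-closed set \<open>no_low n\<close>; the leading monomial of
  the member of \<open>G\<close> then lies there too. If all such members vanish at
  \<open>y\<close>, so does \<open>f\<close>.\<close>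

lemma separates_groebner:
  fixes G :: "(mon \<times> 'k::field mpol) set"
  assumes G: "\<And>u g. (u, g) \<in> G \<Longrightarrow> u \<in> Mon N \<and> keys g \<subseteq> {..u} \<and> lookup g u \<noteq> 0"
    and S: "\<And>u g u' g'. (u, g) \<in> G \<Longrightarrow> (u', g') \<in> G \<Longrightarrow>
      spoly u g u' g' \<in> Span N G (\<lambda>w. w < mlcm u u')"
    and H: "H \<subseteq> Span N G (\<lambda>_. True)"
  shows "separates N n y (snd ` G \<union> H) \<longleftrightarrow> (\<exists>(u, g)\<in>G. u \<in> no_low n \<and> mpoly_eval y g \<noteq> 0)"
proof
  assume "separates N n y (snd ` G \<union> H)"
  then obtain f where f: "f \<in> ideal N (snd ` G \<union> H)" "keys f \<subseteq> no_low n" "mpoly_eval y f \<noteq> 0"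
    unfolding separates_def by blast
  have "f \<in> Span N G (\<lambda>_. True)"
  proof (rule Span_subset[OF f(1)])
    fix u g a assume "(u, g) \<in> (\<lambda>g. (0, g)) ` (snd ` G \<union> H)" and a: "a \<in> Mon N"
    then consider u' where "(u', g) \<in> G" | "g \<in> H" by auto
    then show "single a 1 * g \<in> Span N G (\<lambda>_. True)"
    proof cases
      case 1
      then show ?thesis using a by (intro Span_base[of u']) auto
    next
      case 2
      then show ?thesis using a H by (intro Span_single_mult[of g]) auto
    qed
  qed
  then have std: "f \<in> Span N G (\<lambda>w. \<exists>v\<in>keys f. w \<le> v)"
    using groebner[OF G S] by blast
  show "\<exists>(u, g)\<in>G. u \<in> no_low n \<and> mpoly_eval y g \<noteq> 0"
  proof (rule ccontr)
    assume none: "\<not> (\<exists>(u, g)\<in>G. u \<in> no_low n \<and> mpoly_eval y g \<noteq> 0)"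
    have "mpoly_eval y p = 0" if "p \<in> Span N G (\<lambda>w. \<exists>v\<in>keys f. w \<le> v)" for p
      using that
    proof induction
      case (step p u g a c)
      then obtain v where "v \<in> no_low n" "a + u \<le> v" using f(2) by blast
      then have "u \<in> no_low n" using no_low_downward by fastforce
      then show ?case using step none by (auto simp: mpoly_eval_add mpoly_eval_single_mult)
    qed simp
    then show False using std f(3) by blast
  qed
next
  assume "\<exists>(u, g)\<in>G. u \<in> no_low n \<and> mpoly_eval y g \<noteq> 0"
  then obtain u g where g: "(u, g) \<in> G" "u \<in> no_low n" "mpoly_eval y g \<noteq> 0" by blast
  have "g \<in> ideal N (snd ` G \<union> H)" using g(1) by (intro ideal_base) force
  moreover have "keys g \<subseteq> no_low n" using G[OF g(1)] g(2) no_low_downward by blast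
  ultimately show "separates N n y (snd ` G \<union> H)" unfolding separates_def using g(3) by blast
qed

text \<open>Both products have the same coefficient at the least common multiple, identically in the
  parameter, so this monomial leaves the support and the bound becomes strict.\<close>

lemma poly_family_spoly:
  assumes "leading_family s N S G" "(u, g) \<in> G" "(u', g') \<in> G"
  shows "\<exists>A. poly_family s N S A (\<lambda>T. spoly u (g T) u' (g' T)) \<and> A \<subseteq> {..<mlcm u u'}"
proof -
  obtain A where A: "poly_family s N S A g" "A \<subseteq> {..u}" using leading_familyD(2)[OF assms(1,2)] by blast
  obtain B where B: "poly_family s N S B g'" "B \<subseteq> {..u'}" using leading_familyD(2)[OF assms(1,3)] by blast
  have M: "u \<in> Mon N" "u' \<in> Mon N" using leading_familyD(1)[OF assms(1)] assms(2,3) by blast+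
  define l where "l = mlcm u u'"
  have l: "l = (u' - u) + u" "l = (u - u') + u'"
    using mlcm_commute[of u u'] by (simp_all add: l_def mlcm_def add.commute)
  let ?C = "(+) (u' - u) ` A \<union> (+) (u - u') ` B"
  have P: "(\<lambda>T. lookup (g T) u) \<in> polynomial_functions s"
    "(\<lambda>T. lookup (g' T) u') \<in> polynomial_functions s"
    using A(1) B(1) by (auto simp: poly_family_def)
  have "poly_family s N S ?C (\<lambda>T. spoly u (g T) u' (g' T))"
    unfolding spoly_def by (intro poly_family_diff poly_family_single_mult A(1) B(1) P minus_Mon M)
  moreover have "lookup (spoly u (g T) u' (g' T)) l = 0" for T
  proof -
    have "lookup (single (u' - u) (lookup (g' T) u') * g T) l = lookup (g' T) u' * lookup (g T) u"
      unfolding l(1) by (rule lookup_single_mult_add)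
    moreover have "lookup (single (u - u') (lookup (g T) u) * g' T) l = lookup (g T) u * lookup (g' T) u'"
      unfolding l(2) by (rule lookup_single_mult_add)
    ultimately show ?thesis by (simp add: spoly_def lookup_minus)
  qed
  ultimately have "poly_family s N S (?C - {l}) (\<lambda>T. spoly u (g T) u' (g' T))"
    by (intro poly_family_remove)
  moreover have "x < l" if "x \<in> ?C - {l}" for x
  proof -
    have "x \<le> l"
      using that A(2) B(2) add_left_mono[of _ u "u' - u"] add_left_mono[of _ u' "u - u'"]
      by (auto simp: l(1)[symmetric] l(2)[symmetric])
    then show ?thesis using that by (simp add: order_less_le)
  qed
  ultimately show ?thesis unfolding l_def by (intro exI[of _ "?C - {mlcm u u'}"]) auto
qed

lemma leading_family_insert:
  assumes "leading_family s N S G" "S' \<subseteq> S" "u \<in> Mon N" "poly_family s N S' A r" "A \<subseteq> {..u}"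
    and "\<forall>T\<in>S'. lookup (r T) u \<noteq> 0"
  shows "leading_family s N S' (insert (u, r) G)"
  unfolding leading_family_def
proof (intro conjI ballI, goal_cases)
  case 1
  show ?case using assms(1) by (simp add: leading_family_def)
next
  case (2 z)
  show ?case
  proof (cases "z = (u, r)")
    case True
    then show ?thesis using assms(3-6) by auto
  next
    case False
    then obtain v g where z: "z = (v, g)" "(v, g) \<in> G" using 2 by (cases z) auto
    obtain B where "poly_family s N S B g" "B \<subseteq> {..v}" using leading_familyD(2)[OF assms(1) z(2)] by blast
    then have "poly_family s N S' B g \<and> B \<subseteq> {..v}" using assms(2) poly_family_subset by blast
    then show ?thesis using z leading_familyD(1,3)[OF assms(1) z(2)] assms(2) by auto
  qed
qed

lemma specialize_leading_family:
  assumes "leading_family s N S G" "T \<in> S" "(u, g) \<in> specialize G T"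
  shows "u \<in> Mon N \<and> keys g \<subseteq> {..u} \<and> lookup g u \<noteq> 0"
proof -
  obtain g' where "(u, g') \<in> G" "g = g' T" using assms(3) by (auto simp: specialize_def)
  then show ?thesis using leading_familyD[OF assms(1)] assms(2) by blast
qed

lemma Span_remainder:
  fixes c :: "'k::field"
  assumes "single 0 c * h - r \<in> Span N G Q" "c \<noteq> 0" "r = 0"
  shows "h \<in> Span N G Q"
  using assms by (auto intro: Span_scaleD)

lemma remainder_ideal:
  assumes "single 0 c * h - r \<in> ideal N F" "h \<in> ideal N F"
  shows "r \<in> ideal N F"
  using Span_diff[OF Span_scale[OF assms(2), of c] assms(1)] by simp

text \<open>
  The parameter set is split according to the leading monomials of the remainders of \<open>H\<close> and of
  the S-polynomials. On the piece where all remainders vanish \<open>G\<close> is a Groebner basis; on every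
  other piece a remainder contributes a new leading monomial, so the recursion ends by Dickson's lemma.
\<close>

lemma constructible_separates:
  fixes s :: "'k::field \<Rightarrow> 'w::ab_group_add \<Rightarrow> 'w"
  assumes N: "N > 0"
  shows "constructible_in (zariski s W) S \<Longrightarrow> leading_family s N S G \<Longrightarrow> fst ` G = E \<Longrightarrow> finite H \<Longrightarrow>
    \<forall>h\<in>H. \<exists>A. poly_family s N S A h \<Longrightarrow>
    constructible_in (zariski s W) {T \<in> S. separates N n y ((\<lambda>g. g T) ` (snd ` G \<union> H))}"
proof (induction E arbitrary: S G rule: wf_induct_rule[OF wf_new_monomial[of N]])
  case (1 E)
  note con = 1(2) and st = 1(3)
  define F where "F T = (\<lambda>g. g T) ` (snd ` G \<union> H)" for T
  have F_eq: "F T = snd ` specialize G T \<union> (\<lambda>h. h T) ` H" for T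
    unfolding F_def specialize_def by force
  have finG: "finite G" using st by (simp add: leading_family_def)
  have G_ideal: "snd ` specialize G T \<subseteq> ideal N (F T)" for T
    using ideal_base[of _ "F T" N] F_eq by blast
  \<comment> \<open>Whichever monomial of such a support turns out to lead \<open>r\<close>, adding
    it to \<open>E\<close> is a step of the well-founded relation.\<close>
  define new where "new r \<longleftrightarrow> (\<exists>B. poly_family s N S B r \<and> (\<forall>w\<in>B. \<forall>e\<in>E. \<forall>a. w \<noteq> a + e))" for r
  have newI: "poly_family s N S B r \<Longrightarrow> \<forall>w\<in>B. \<not> reducible (fst ` G) w \<Longrightarrow> new r" for B r
    using 1(4) unfolding new_def reducible_def by blast
  have "\<exists>r. new r \<and>
      (\<forall>T\<in>S. r T \<in> ideal N (F T) \<and> (r T = 0 \<longrightarrow> h T \<in> Span N (specialize G T) (\<lambda>_. True)))"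
    if h: "h \<in> H" for h
  proof -
    obtain A where A: "poly_family s N S A h" using 1(6) h by blast
    obtain r B where r: "poly_family s N S B r" "\<forall>w\<in>B. \<not> reducible (fst ` G) w"
      "\<forall>T\<in>S. \<exists>c. c \<noteq> 0 \<and> single 0 c * h T - r T \<in> Span N (specialize G T) (\<lambda>w. \<exists>x\<in>A. w \<le> x)"
      using reduce_family[OF st A N] by blast
    have "r T \<in> ideal N (F T) \<and> (r T = 0 \<longrightarrow> h T \<in> Span N (specialize G T) (\<lambda>_. True))" if T: "T \<in> S" for T
    proof -
      obtain c where c: "c \<noteq> 0" "single 0 c * h T - r T \<in> Span N (specialize G T) (\<lambda>w. \<exists>x\<in>A. w \<le> x)"
        using r(3) T by blast
      then have sp: "single 0 c * h T - r T \<in> Span N (specialize G T) (\<lambda>_. True)"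
        by (elim Span_mono) auto
      have "h T \<in> ideal N (F T)" using h by (intro ideal_base) (auto simp: F_def)
      then have "r T \<in> ideal N (F T)"
        using remainder_ideal[OF Span_ideal[OF sp G_ideal]] by blast
      then show ?thesis using Span_remainder[OF sp c(1)] by blast
    qed
    then show ?thesis using newI[OF r(1,2)] by blast
  qed
  then have "\<forall>h\<in>H. \<exists>r. new r \<and>
      (\<forall>T\<in>S. r T \<in> ideal N (F T) \<and> (r T = 0 \<longrightarrow> h T \<in> Span N (specialize G T) (\<lambda>_. True)))"
    by (rule ballI)
  from bchoice[OF this] obtain rH where rH: "\<forall>h\<in>H. new (rH h) \<and>
      (\<forall>T\<in>S. rH h T \<in> ideal N (F T) \<and> (rH h T = 0 \<longrightarrow> h T \<in> Span N (specialize G T) (\<lambda>_. True)))"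
    by (rule exE)
  have "\<exists>r. new r \<and>
      (\<forall>T\<in>S. r T \<in> ideal N (F T) \<and> (r T = 0 \<longrightarrow>
        spoly (fst p) (snd p T) (fst q) (snd q T) \<in> Span N (specialize G T) (\<lambda>w. w < mlcm (fst p) (fst q))))"
    if pq: "p \<in> G" "q \<in> G" for p q
  proof -
    define h where "h T = spoly (fst p) (snd p T) (fst q) (snd q T)" for T
    obtain A where A: "poly_family s N S A h" "A \<subseteq> {..<mlcm (fst p) (fst q)}"
      using poly_family_spoly[OF st, of "fst p" "snd p" "fst q" "snd q"] pq unfolding h_def by auto
    obtain r B where r: "poly_family s N S B r" "\<forall>w\<in>B. \<not> reducible (fst ` G) w"
      "\<forall>T\<in>S. \<exists>c. c \<noteq> 0 \<and> single 0 c * h T - r T \<in> Span N (specialize G T) (\<lambda>w. \<exists>x\<in>A. w \<le> x)"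
      using reduce_family[OF st A(1) N] by blast
    have "r T \<in> ideal N (F T) \<and> (r T = 0 \<longrightarrow> h T \<in> Span N (specialize G T) (\<lambda>w. w < mlcm (fst p) (fst q)))"
      if T: "T \<in> S" for T
    proof -
      obtain c where c: "c \<noteq> 0" "single 0 c * h T - r T \<in> Span N (specialize G T) (\<lambda>w. \<exists>x\<in>A. w \<le> x)"
        using r(3) T by blast
      \<comment> \<open>The support of the S-polynomial lies strictly below the least common
        multiple, so a vanishing remainder gives exactly the representation demanded by Buchberger's
        criterion.\<close>
      then have sp: "single 0 c * h T - r T \<in> Span N (specialize G T) (\<lambda>w. w < mlcm (fst p) (fst q))"
        using A(2) by (elim Span_mono) (auto intro: le_less_trans)
      have "snd p T \<in> ideal N (F T)" "snd q T \<in> ideal N (F T)"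
        using pq by (auto intro!: ideal_base simp: F_def)
      moreover have "fst p \<in> Mon N" "fst q \<in> Mon N"
        using leading_familyD(1)[OF st] pq by (metis prod.collapse)+
      ultimately have "h T \<in> ideal N (F T)"
        unfolding h_def spoly_def by (intro Span_diff Span_single_mult[of _ N _ "\<lambda>_. True"] minus_Mon) auto
      then have "r T \<in> ideal N (F T)"
        using remainder_ideal[OF Span_ideal[OF sp G_ideal]] by blast
      then show ?thesis using Span_remainder[OF sp c(1)] by blast
    qed
    then show ?thesis using newI[OF r(1,2)] unfolding h_def by blast
  qed
  then have "\<forall>z\<in>G \<times> G. \<exists>r. new r \<and>
      (\<forall>T\<in>S. r T \<in> ideal N (F T) \<and> (r T = 0 \<longrightarrow>
        spoly (fst (fst z)) (snd (fst z) T) (fst (snd z)) (snd (snd z) T) \<in>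
          Span N (specialize G T) (\<lambda>w. w < mlcm (fst (fst z)) (fst (snd z)))))"
    by auto
  from bchoice[OF this] obtain rS where rS: "\<forall>z\<in>G \<times> G. new (rS z) \<and>
      (\<forall>T\<in>S. rS z T \<in> ideal N (F T) \<and> (rS z T = 0 \<longrightarrow>
        spoly (fst (fst z)) (snd (fst z) T) (fst (snd z)) (snd (snd z) T) \<in>
          Span N (specialize G T) (\<lambda>w. w < mlcm (fst (fst z)) (fst (snd z)))))"
    by (rule exE)
  define R where "R = rH ` H \<union> rS ` (G \<times> G)"
  have finR: "finite R" unfolding R_def using finG 1(5) by simp
  have R_ideal: "r T \<in> ideal N (F T)" if "r \<in> R" "T \<in> S" for r T
    using that rH rS unfolding R_def by blast
  have "\<forall>r\<in>R. \<exists>B. poly_family s N S B r \<and> (\<forall>w\<in>B. \<forall>e\<in>E. \<forall>a. w \<noteq> a + e)"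
    unfolding R_def new_def[symmetric] using rH rS by blast
  from bchoice[OF this] obtain B where
    B': "\<forall>r\<in>R. poly_family s N S (B r) r \<and> (\<forall>w\<in>B r. \<forall>e\<in>E. \<forall>a. w \<noteq> a + e)"
    by (rule exE)
  have B: "poly_family s N S (B r) r" "w \<in> B r \<Longrightarrow> e \<in> E \<Longrightarrow> w \<noteq> a + e" if "r \<in> R" for r w e a
    using bspec[OF B' that] by blast+
  have finB: "finite (B r)" "B r \<subseteq> Mon N" if "r \<in> R" for r
    using B(1)[OF that] by (auto simp: poly_family_def)
  have PB: "(\<lambda>T. lookup (r T) u) \<in> polynomial_functions s" if "r \<in> R" for r u
    using B(1)[OF that] by (auto simp: poly_family_def)
  define S0 where "S0 = {T \<in> S. \<forall>r\<in>R. r T = 0}"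
  \<comment> \<open>On \<open>S1 r u\<close> the remainder \<open>r\<close> has leading monomial
    \<open>u\<close>. Pieces belonging to different \<open>r\<close> may overlap; together with
    \<open>S0\<close> they have to cover \<open>S\<close>.\<close>
  define S1 where "S1 r u = {T \<in> S. lookup (r T) u \<noteq> 0 \<and> (\<forall>w\<in>B r. u < w \<longrightarrow> lookup (r T) w = 0)}" for r u
  define X where "X = {T \<in> S. separates N n y (F T)}"

  have "constructible_in (zariski s W) (S1 r u \<inter> X)" if r: "r \<in> R" and u: "u \<in> B r" for r u
  proof -
    have "constructible_in (zariski s W)
        {T \<in> {T \<in> S. \<forall>p\<in>(\<lambda>w T. lookup (r T) w) ` {w \<in> B r. u < w}. p T = 0}. lookup (r T) u \<noteq> 0}"
      using finB[OF r] PB[OF r] con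
      by (intro constructible_zariski_neq_0 constructible_zariski_all_eq_0) auto
    moreover have "{T \<in> {T \<in> S. \<forall>p\<in>(\<lambda>w T. lookup (r T) w) ` {w \<in> B r. u < w}. p T = 0}. lookup (r T) u \<noteq> 0}
        = S1 r u"
      unfolding S1_def by auto
    ultimately have c1: "constructible_in (zariski s W) (S1 r u)" by simp
    have sub: "S1 r u \<subseteq> S" unfolding S1_def by blast
    have "keys (r T) \<subseteq> {..u}" if "T \<in> S1 r u" for T
    proof
      fix w assume w: "w \<in> keys (r T)"
      then have "w \<in> B r" using B(1)[OF r] that sub by (auto simp: poly_family_def)
      then have "\<not> u < w" using that w by (auto simp: S1_def in_keys_iff)
      then show "w \<in> {..u}" by simp
    qed
    then have "poly_family s N (S1 r u) (B r \<inter> {..u}) r"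
      using B(1)[OF r] sub unfolding poly_family_def by blast
    moreover have "\<forall>T\<in>S1 r u. lookup (r T) u \<noteq> 0" by (simp add: S1_def)
    ultimately have st': "leading_family s N (S1 r u) (insert (u, r) G)"
      using finB(2)[OF r] u by (intro leading_family_insert[OF st sub]) auto
    have "constructible_in (zariski s W)
        {T \<in> S1 r u. separates N n y ((\<lambda>g. g T) ` (snd ` insert (u, r) G \<union> H))}"
    \<comment> \<open>\<open>H\<close> is kept and divided again by the enlarged family; progress is
      measured by the leading monomials alone.\<close>
    proof (rule 1(1)[OF _ c1 st' refl 1(5)])
      show "(fst ` insert (u, r) G, E) \<in> {(E', E). \<exists>u\<in>Mon N. E' = insert u E \<and> (\<forall>e\<in>E. \<forall>a. u \<noteq> a + e)}"
        using 1(4) u finB[OF r] B(2)[OF r u] by auto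
      show "\<forall>h\<in>H. \<exists>A. poly_family s N (S1 r u) A h" using 1(6) sub poly_family_subset by blast
    qed
    moreover have "separates N n y ((\<lambda>g. g T) ` (snd ` insert (u, r) G \<union> H)) \<longleftrightarrow> separates N n y (F T)"
      if "T \<in> S1 r u" for T
    proof -
      have "(\<lambda>g. g T) ` (snd ` insert (u, r) G \<union> H) = insert (r T) (F T)" by (auto simp: F_def)
      moreover have "insert (r T) (F T) \<subseteq> ideal N (F T)"
        using R_ideal[OF r] that sub ideal_base[of _ "F T" N] by blast
      ultimately show ?thesis using separates_cong[of "F T" "insert (r T) (F T)" N n y] by auto
    qed
    ultimately have "constructible_in (zariski s W) {T \<in> S1 r u. separates N n y (F T)}"
      by (simp cong: conj_cong)
    moreover have "{T \<in> S1 r u. separates N n y (F T)} = S1 r u \<inter> X" using sub by (auto simp: X_def)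
    ultimately show ?thesis by simp
  qed
  then have part1: "constructible_in (zariski s W) (\<Union>r\<in>R. \<Union>u\<in>B r. S1 r u \<inter> X)"
    using finR finB by (intro constructible_in_UN) auto

  have part0: "constructible_in (zariski s W) (S0 \<inter> X)"
  proof -
    have "constructible_in (zariski s W)
        {T \<in> S. \<forall>p\<in>(\<lambda>(r, w) T. lookup (r T) w) ` (SIGMA r:R. B r). p T = 0}"
      using finR finB PB con by (intro constructible_zariski_all_eq_0) auto
    moreover have "r T = 0 \<longleftrightarrow> (\<forall>w\<in>B r. lookup (r T) w = 0)" if "r \<in> R" "T \<in> S" for r T
    proof
      assume z: "\<forall>w\<in>B r. lookup (r T) w = 0"
      have "keys (r T) \<subseteq> B r" using B(1)[OF that(1)] that(2) by (auto simp: poly_family_def)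
      then have "\<forall>w. w \<notin> keys (r T)" using z by (auto simp: in_keys_iff)
      then show "r T = 0" by (metis keys_eq_empty all_not_in_conv)
    qed simp
    then have "{T \<in> S. \<forall>p\<in>(\<lambda>(r, w) T. lookup (r T) w) ` (SIGMA r:R. B r). p T = 0} = S0"
      unfolding S0_def by auto
    ultimately have c0: "constructible_in (zariski s W) S0" by simp
    \<comment> \<open>On \<open>S0\<close> every remainder is zero, so each specialization of
      \<open>G\<close> satisfies Buchberger's criterion and represents \<open>H\<close>. The same
      finitely many families are then tested at \<open>y\<close> for all these
      \<open>T\<close>.\<close>
    have eq: "separates N n y (F T) \<longleftrightarrow> (\<exists>(u, g)\<in>G. u \<in> no_low n \<and> mpoly_eval y (g T) \<noteq> 0)" if T: "T \<in> S0" for T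
    proof -
      have TS: "T \<in> S" and z: "\<And>r. r \<in> R \<Longrightarrow> r T = 0" using T by (auto simp: S0_def)
      have "separates N n y (F T) \<longleftrightarrow> (\<exists>(u, g)\<in>specialize G T. u \<in> no_low n \<and> mpoly_eval y g \<noteq> 0)"
        unfolding F_eq
      proof (rule separates_groebner)
        show "u \<in> Mon N \<and> keys g \<subseteq> {..u} \<and> lookup g u \<noteq> 0" if "(u, g) \<in> specialize G T" for u g
          using specialize_leading_family[OF st TS that] .
        show "(\<lambda>h. h T) ` H \<subseteq> Span N (specialize G T) (\<lambda>_. True)"
          using rH TS z unfolding R_def by blast
        show "spoly u g u' g' \<in> Span N (specialize G T) (\<lambda>w. w < mlcm u u')"
          if ug: "(u, g) \<in> specialize G T" "(u', g') \<in> specialize G T" for u g u' g'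
        proof -
          obtain k k' where k: "(u, k) \<in> G" "g = k T" "(u', k') \<in> G" "g' = k' T"
            using ug unfolding specialize_def by auto
          define q where "q = ((u, k), (u', k'))"
          have q: "q \<in> G \<times> G" using k by (simp add: q_def)
          then have "rS q T = 0" using z unfolding R_def by blast
          then show ?thesis using bspec[OF rS q] TS k by (simp add: q_def)
        qed
      qed
      then show ?thesis unfolding specialize_def by (simp add: case_prod_unfold)
    qed
    have "constructible_in (zariski s W) (\<Union>(u, g)\<in>{(u, g)\<in>G. u \<in> no_low n}. {T \<in> S0. mpoly_eval y (g T) \<noteq> 0})"
    proof (intro constructible_in_UN)
      show "finite {(u, g)\<in>G. u \<in> no_low n}" by (rule finite_subset[OF _ finG]) auto
      fix p assume "p \<in> {(u, g)\<in>G. u \<in> no_low n}"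
      then obtain u g where p: "p = (u, g)" "(u, g) \<in> G" by auto
      obtain A where "poly_family s N S A g" using leading_familyD(2)[OF st p(2)] by blast
      then obtain e where e: "e \<in> polynomial_functions s" "\<forall>T\<in>S. mpoly_eval y (g T) = e T"
        using poly_family_mpoly_eval by blast
      then have "{T \<in> S0. mpoly_eval y (g T) \<noteq> 0} = {T \<in> S0. e T \<noteq> 0}" by (auto simp: S0_def)
      then show "constructible_in (zariski s W) (case p of (u, g) \<Rightarrow> {T \<in> S0. mpoly_eval y (g T) \<noteq> 0})"
        using constructible_zariski_neq_0[OF c0 e(1)] p by simp
    qed
    moreover have "(\<Union>(u, g)\<in>{(u, g)\<in>G. u \<in> no_low n}. {T \<in> S0. mpoly_eval y (g T) \<noteq> 0}) = S0 \<inter> X"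
    proof -
      have "S0 \<inter> X = {T \<in> S0. separates N n y (F T)}" by (auto simp: S0_def X_def)
      also have "\<dots> = {T \<in> S0. \<exists>(u, g)\<in>G. u \<in> no_low n \<and> mpoly_eval y (g T) \<noteq> 0}" using eq by blast
      finally show ?thesis by auto
    qed
    ultimately show ?thesis by simp
  qed
  have "X = (S0 \<inter> X) \<union> (\<Union>r\<in>R. \<Union>u\<in>B r. S1 r u \<inter> X)"
  proof -
    have "T \<in> S0 \<or> (\<exists>r\<in>R. \<exists>u\<in>B r. T \<in> S1 r u)" if T: "T \<in> S" for T
    proof (rule disjCI)
      assume no: "\<not> (\<exists>r\<in>R. \<exists>u\<in>B r. T \<in> S1 r u)"
      have "r T = 0" if r: "r \<in> R" for r
      proof (rule ccontr)
        assume "r T \<noteq> 0"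
        then have ne: "keys (r T) \<noteq> {}" by simp
        define u where "u = Max (keys (r T))"
        have "u \<in> keys (r T)" unfolding u_def using ne by (intro Max_in) auto
        moreover from this have "u \<in> B r" using B(1)[OF r] T by (auto simp: poly_family_def)
        moreover have "lookup (r T) w = 0" if "u < w" for w
        proof (rule ccontr)
          assume "lookup (r T) w \<noteq> 0"
          then have "w \<le> u" unfolding u_def by (intro Max_ge) (auto simp: in_keys_iff)
          then show False using that by simp
        qed
        ultimately have "T \<in> S1 r u" using T by (auto simp: S1_def in_keys_iff)
        then show False using no r \<open>u \<in> B r\<close> by blast
      qed
      then show "T \<in> S0" using T by (simp add: S0_def)
    qed
    then show ?thesis unfolding X_def by blast
  qed
  from constructible_in_Un[OF part0 part1, folded this]
  have "constructible_in (zariski s W) X" .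
  then show ?case unfolding X_def F_def .
qed


subsection \<open>Families of images of polynomial maps\<close>

text \<open>Over a finite field the product of all \<open>x - a\<close> is zero everywhere, so
  adding \<open>1\<close> gives a polynomial of positive degree without roots.\<close>

lemma alg_closed_infinite: "infinite (UNIV :: 'k::alg_closed_field set)"
proof
  assume fin: "finite (UNIV :: 'k set)"
  define q where "q = (\<Prod>a\<in>(UNIV :: 'k set). [:-a, 1:])"
  have "degree q = card (UNIV :: 'k set)"
    unfolding q_def by (subst degree_prod_eq_sum_degree) auto
  then have "degree q > 0" using fin by (simp add: finite_UNIV_card_ge_0)
  then have "degree (q + 1) > 0" by (subst degree_add_eq_left) auto
  then obtain x where "poly (q + 1) x = 0" using alg_closed_imp_poly_has_root by blast
  moreover have "poly q x = 0"
    unfolding q_def poly_prod using fin by (intro prod_zero) auto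
  ultimately show False by simp
qed

text \<open>With the other variables fixed, the sum is a polynomial in the last one that vanishes at
  infinitely many points. Its coefficient at the power \<open>e u n\<close> is a sum of the same
  kind in one variable less, over the exponents that agree with \<open>u\<close> at
  \<open>n\<close>; among these, agreement in the remaining variables still forces equality.\<close>

lemma monomials_independent:
  fixes c :: "'a \<Rightarrow> 'k::field" and e :: "'a \<Rightarrow> nat \<Rightarrow> nat"
  assumes inf: "infinite (UNIV :: 'k set)"
  shows "finite A \<Longrightarrow> (\<And>u v. u \<in> A \<Longrightarrow> v \<in> A \<Longrightarrow> (\<And>i. i < n \<Longrightarrow> e u i = e v i) \<Longrightarrow> u = v) \<Longrightarrow>
    (\<And>x. (\<Sum>u\<in>A. c u * (\<Prod>i<n. x i ^ e u i)) = 0) \<Longrightarrow> u \<in> A \<Longrightarrow> c u = 0"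
proof (induction n arbitrary: A u)
  case 0
  then have "A = {u}" by blast
  then show ?case using 0(3) by simp
next
  case (Suc n)
  define B where "B = {v \<in> A. e v n = e u n}"
  have B: "finite B" "u \<in> B" using Suc.prems(1,4) by (auto simp: B_def)
  have "(\<Sum>v\<in>B. c v * (\<Prod>i<n. x i ^ e v i)) = 0" for x
  proof -
    define p where "p = (\<Sum>v\<in>A. monom (c v * (\<Prod>i<n. x i ^ e v i)) (e v n))"
    have "poly p t = 0" for t
    proof -
      have "poly p t = (\<Sum>v\<in>A. c v * (\<Prod>i<Suc n. (x(n := t)) i ^ e v i))"
        unfolding p_def by (simp add: poly_sum poly_monom algebra_simps)
      then show ?thesis by (simp only: Suc.prems(3))
    qed
    then have "p = 0" using poly_roots_finite[of p] inf by auto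
    then have "coeff p (e u n) = 0" by simp
    moreover have "coeff p (e u n) = (\<Sum>v\<in>A. if e v n = e u n then c v * (\<Prod>i<n. x i ^ e v i) else 0)"
      unfolding p_def by (simp add: coeff_sum)
    moreover have "\<dots> = (\<Sum>v\<in>B. c v * (\<Prod>i<n. x i ^ e v i))"
      unfolding B_def using Suc.prems(1) by (simp add: sum.inter_filter)
    ultimately show ?thesis by simp
  qed
  moreover have "v = w" if "v \<in> B" "w \<in> B" "\<And>i. i < n \<Longrightarrow> e v i = e w i" for v w
    using that by (intro Suc.prems(2)) (auto simp: B_def less_Suc_eq)
  ultimately show ?case using Suc.IH[OF B(1) _ _ B(2)] by blast
qed

lemma mpoly_eval_eq_0_imp:
  fixes f :: "'k::field mpol"
  assumes "infinite (UNIV :: 'k set)" "keys f \<subseteq> Mon n" "\<And>x. mpoly_eval x f = 0"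
  shows "f = 0"
proof -
  have "lookup f u = 0" if "u \<in> keys f" for u
  proof (rule monomials_independent[OF assms(1), of "keys f" n lookup])
    fix v w :: mon assume vw: "v \<in> keys f" "w \<in> keys f" "\<And>i. i < n \<Longrightarrow> lookup v i = lookup w i"
    show "v = w"
    proof (rule poly_mapping_eqI)
      fix i
      show "lookup v i = lookup w i"
      proof (cases "i < n")
        case False
        then have "i \<notin> keys v" "i \<notin> keys w" using vw assms(2) by (auto simp: Mon_def)
        then show ?thesis by (simp add: in_keys_iff)
      qed (use vw in simp)
    qed
  next
    fix x
    have "mpoly_eval x f = (\<Sum>u\<in>keys f. lookup f u * (\<Prod>i<n. x i ^ lookup u i))"
      unfolding mpoly_eval_def using assms(2)
      by (intro sum.cong arg_cong2[where f="(*)"] mon_eval_superset) (auto simp: Mon_def)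
    then show "(\<Sum>u\<in>keys f. lookup f u * (\<Prod>i<n. x i ^ lookup u i)) = 0"
      using assms(3) by simp
  qed (use that in auto)
  then have "\<forall>u. u \<notin> keys f" by (metis in_keys_iff)
  then show ?thesis by (metis keys_eq_empty all_not_in_conv)
qed

lemma keys_ideal:
  assumes "p \<in> ideal N F" "\<And>g. g \<in> F \<Longrightarrow> keys g \<subseteq> Mon N"
  shows "keys p \<subseteq> Mon N"
  using assms(1)
proof induction
  case (step p u g a c)
  have "keys g \<subseteq> Mon N" using step(2) assms(2) by auto
  then have "keys (single a c * g) \<subseteq> Mon N"
    using keys_single_mult[of a c g] step(3) by fastforce
  then show ?case using step(5) keys_add[of p "single a c * g"] by blast
qed simp

text \<open>The graph of a map given by \<open>\<phi>\<close>, whose target has the coordinates \<open>n, \<dots>, N - 1\<close>.\<close>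

definition graph :: "nat \<Rightarrow> nat \<Rightarrow> (nat \<Rightarrow> 'k::comm_ring_1 mpol) \<Rightarrow> 'k mpol set" where
  "graph n N \<phi> = (\<lambda>i. single (single i 1) 1 - \<phi> i) ` {n..<N}"

text \<open>Induction on the total degree \<open>k\<close> in the target variables: each step trades
  one factor, variable \<open>i\<close>, for \<open>\<phi> i\<close>.\<close>

lemma graph_eliminate_single:
  assumes \<phi>: "\<And>i. n \<le> i \<Longrightarrow> i < N \<Longrightarrow> keys (\<phi> i) \<subseteq> Mon n" and "n \<le> N"
  shows "u \<in> Mon N \<Longrightarrow> (\<Sum>i=n..<N. lookup u i) = k \<Longrightarrow>
    \<exists>f. keys f \<subseteq> Mon n \<and> single u c - f \<in> ideal N (graph n N \<phi>)"
proof (induction k arbitrary: u)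
  case 0
  have "i < n" if "i \<in> keys u" for i
  proof (rule ccontr)
    assume "\<not> i < n"
    then have "lookup u i = 0" using 0 that by (auto simp: Mon_def)
    then show False using that by (simp add: in_keys_iff)
  qed
  then have "keys (single u c) \<subseteq> Mon n" by (auto simp: Mon_def split: if_splits)
  then show ?case by (intro exI[of _ "single u c"]) (simp add: Span.zero)
next
  case (Suc k)
  have "\<exists>i\<in>{n..<N}. lookup u i \<noteq> 0"
  proof (rule ccontr)
    assume "\<not> ?thesis"
    then have "(\<Sum>i=n..<N. lookup u i) = 0" by simp
    then show False using Suc.prems by simp
  qed
  then obtain i where i: "n \<le> i" "i < N" "lookup u i \<noteq> 0" by auto
  define a where "a = u - single i 1"
  have u: "u = a + single i 1"
    by (rule poly_mapping_eqI) (use i in \<open>auto simp: a_def lookup_add lookup_minus_nat lookup_single when_def\<close>)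
  have aM: "a \<in> Mon N" unfolding a_def using Suc.prems by (intro minus_Mon)
  have "(\<Sum>j=n..<N. lookup u j) = (\<Sum>j=n..<N. lookup a j) + 1"
    using i by (simp add: u lookup_add lookup_single when_def sum.distrib)
  then have "(\<Sum>j=n..<N. lookup a j) = k" using Suc.prems by simp
  then obtain f where f: "keys f \<subseteq> Mon n" "single a c - f \<in> ideal N (graph n N \<phi>)"
    using Suc.IH aM by blast
  have "single a c * (single (single i 1) 1 - \<phi> i) \<in> ideal N (graph n N \<phi>)"
    using i aM by (intro Span_single_mult[OF ideal_base]) (auto simp: graph_def)
  moreover have "\<phi> i * (single a c - f) \<in> ideal N (graph n N \<phi>)"
    using \<phi>[OF i(1,2)] Mon_mono[OF \<open>n \<le> N\<close>] by (intro Span_mult f(2)) auto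
  ultimately have "single a c * (single (single i 1) 1 - \<phi> i) + \<phi> i * (single a c - f)
      \<in> ideal N (graph n N \<phi>)"
    by (rule Span_add)
  moreover have "single a c * (single (single i 1) 1 - \<phi> i) + \<phi> i * (single a c - f) =
      single u c - \<phi> i * f"
    unfolding right_diff_distrib mult_single u[symmetric] by (simp add: mult.commute)
  moreover have "keys (\<phi> i * f) \<subseteq> Mon n"
    using keys_mult[of "\<phi> i" f] \<phi>[OF i(1,2)] f(1) by fastforce
  ultimately show ?case by auto
qed

lemma graph_eliminate:
  assumes \<phi>: "\<And>i. n \<le> i \<Longrightarrow> i < N \<Longrightarrow> keys (\<phi> i) \<subseteq> Mon n" and "n \<le> N"
    and g: "keys g \<subseteq> Mon N"
  shows "\<exists>f. keys f \<subseteq> Mon n \<and> g - f \<in> ideal N (graph n N \<phi>)"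
proof -
  have "\<exists>f. keys f \<subseteq> Mon n \<and> (\<Sum>u\<in>K. single u (lookup g u)) - f \<in> ideal N (graph n N \<phi>)"
    if "finite K" "K \<subseteq> Mon N" for K
    using that
  proof (induction K rule: finite_induct)
    case empty
    then show ?case by (intro exI[of _ 0]) (simp add: Span.zero)
  next
    case (insert u K)
    then obtain f where f: "keys f \<subseteq> Mon n"
      "(\<Sum>u\<in>K. single u (lookup g u)) - f \<in> ideal N (graph n N \<phi>)" by blast
    obtain f' where f': "keys f' \<subseteq> Mon n" "single u (lookup g u) - f' \<in> ideal N (graph n N \<phi>)"
      using graph_eliminate_single[where \<phi>=\<phi>, OF \<phi> \<open>n \<le> N\<close> _ refl, of u] insert.prems by blast
    have "keys (f' + f) \<subseteq> Mon n" using f(1) f'(1) keys_add[of f' f] by blast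
    moreover have "(\<Sum>u\<in>insert u K. single u (lookup g u)) - (f' + f) \<in> ideal N (graph n N \<phi>)"
      using Span_add[OF f'(2) f(2)] insert.hyps by (simp add: algebra_simps)
    ultimately show ?case by blast
  qed
  from this[OF finite_keys g] show ?thesis by (simp flip: poly_mapping_sum_single)
qed

text \<open>No Nullstellensatz is involved: modulo the graph equations every polynomial equals one
  in the source variables. Its values on the graph are its values at all points, and over an
  infinite field only the zero polynomial vanishes at all of them.\<close>

lemma ideal_graph_iff:
  fixes \<phi> :: "nat \<Rightarrow> 'k::field mpol"
  assumes inf: "infinite (UNIV :: 'k set)"
    and \<phi>: "\<And>i. n \<le> i \<Longrightarrow> i < N \<Longrightarrow> keys (\<phi> i) \<subseteq> Mon n" and "n \<le> N"
    and g: "keys g \<subseteq> Mon N"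
  shows "g \<in> ideal N (graph n N \<phi>) \<longleftrightarrow> (\<forall>x. mpoly_eval (\<lambda>i. if i < n then x i else mpoly_eval x (\<phi> i)) g = 0)"
proof -
  define pt where "pt x i = (if i < n then x i else mpoly_eval x (\<phi> i))" for x i
  have pt: "mpoly_eval (pt x) f = mpoly_eval x f" if "keys f \<subseteq> Mon n" for f x
    using that by (intro mpoly_eval_cong) (auto simp: pt_def Mon_def)
  have van: "mpoly_eval (pt x) p = 0" if "p \<in> ideal N (graph n N \<phi>)" for p x
    using that
  proof induction
    case (step p u h a c)
    then obtain i where "n \<le> i" "i < N" "h = single (single i 1) 1 - \<phi> i" by (auto simp: graph_def)
    then have "mpoly_eval (pt x) h = 0" using pt[OF \<phi>] by (simp add: mpoly_eval_diff) (simp add: pt_def)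
    then show ?case using step by (simp add: mpoly_eval_add mpoly_eval_single_mult)
  qed simp
  have "g \<in> ideal N (graph n N \<phi>)" if z: "\<forall>x. mpoly_eval (pt x) g = 0"
  proof -
    obtain f where f: "keys f \<subseteq> Mon n" "g - f \<in> ideal N (graph n N \<phi>)"
      using graph_eliminate[where \<phi>=\<phi>, OF \<phi> \<open>n \<le> N\<close> g] by blast
    have "mpoly_eval x f = 0" for x
      using van[OF f(2), of x] z pt[OF f(1), of x] by (simp add: mpoly_eval_diff)
    then have "f = 0" using mpoly_eval_eq_0_imp[OF inf f(1)] by blast
    then show ?thesis using f(2) by simp
  qed
  then show ?thesis using van unfolding pt_def by blast
qed

text \<open>The algorithm starts without leading monomials: \<open>G\<close> is empty and the graph
  equations form \<open>H\<close>. Target coordinates are numbered after the source variables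
  because the order eliminates the small indices.\<close>

lemma constructible_separated_from_image:
  fixes s :: "'k::field \<Rightarrow> 'w::ab_group_add \<Rightarrow> 'w" and \<phi> :: "nat \<Rightarrow> 'w \<Rightarrow> 'k mpol"
  assumes inf: "infinite (UNIV :: 'k set)" and "n \<le> N" "0 < N"
    and \<phi>: "\<And>i. n \<le> i \<Longrightarrow> i < N \<Longrightarrow> \<exists>A. poly_family s n W A (\<phi> i)"
  shows "constructible_in (zariski s W) {T \<in> W. \<exists>f. keys f \<subseteq> Mon N \<inter> no_low n \<and> mpoly_eval y f \<noteq> 0 \<and>
      (\<forall>x. mpoly_eval (\<lambda>i. if i < n then x i else mpoly_eval x (\<phi> i T)) f = 0)}"
proof -
  define H where "H = (\<lambda>i T. single (single i 1) 1 - \<phi> i T) ` {n..<N}"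
  have \<phi>_keys: "keys (\<phi> i T) \<subseteq> Mon n" if "n \<le> i" "i < N" "T \<in> W" for i T
    using \<phi>[OF that(1,2)] that(3) unfolding poly_family_def by blast
  have "Mon n \<subseteq> Mon N" using \<open>n \<le> N\<close> by (rule Mon_mono)
  have "\<exists>A. poly_family s N W A h" if h: "h \<in> H" for h
  proof -
    obtain i where i: "n \<le> i" "i < N" "h = (\<lambda>T. single (single i 1) 1 - \<phi> i T)"
      using h by (auto simp: H_def)
    obtain A where "poly_family s n W A (\<phi> i)" using \<phi>[OF i(1,2)] by blast
    then have A: "poly_family s N W A (\<phi> i)" using \<open>Mon n \<subseteq> Mon N\<close> by (auto simp: poly_family_def)
    have "poly_family s N W {single i 1} (\<lambda>T. single (single i 1) 1)"
      using i(2) by (intro poly_family_single polynomial_functions.const) (simp add: Mon_def)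
    from poly_family_diff[OF this A] show ?thesis unfolding i(3) by (rule exI)
  qed
  then have "constructible_in (zariski s W)
      {T \<in> W. separates N n y ((\<lambda>g. g T) ` (snd ` ({} :: (mon \<times> ('w \<Rightarrow> 'k mpol)) set) \<union> H))}"
    using \<open>0 < N\<close> constructible_in_topspace[of "zariski s W"]
    by (intro constructible_separates[OF _ _ _ refl])
      (auto simp: leading_family_def H_def)
  moreover have "(\<lambda>g. g T) ` (snd ` ({} :: (mon \<times> ('w \<Rightarrow> 'k mpol)) set) \<union> H) =
      graph n N (\<lambda>i. \<phi> i T)" for T
    by (auto simp: H_def graph_def)
  moreover have "separates N n y (graph n N (\<lambda>i. \<phi> i T)) \<longleftrightarrow>
      (\<exists>f. keys f \<subseteq> Mon N \<inter> no_low n \<and> mpoly_eval y f \<noteq> 0 \<and>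
        (\<forall>x. mpoly_eval (\<lambda>i. if i < n then x i else mpoly_eval x (\<phi> i T)) f = 0))" if T: "T \<in> W" for T
  proof -
    have k1: "keys f \<subseteq> Mon N" if "f \<in> ideal N (graph n N (\<lambda>i. \<phi> i T))" for f
    proof (rule keys_ideal[OF that])
      fix g assume "g \<in> graph n N (\<lambda>i. \<phi> i T)"
      then obtain i where i: "n \<le> i" "i < N" "g = single (single i 1) 1 - \<phi> i T"
        by (auto simp: graph_def)
      have "keys (single (single i 1) 1 :: 'k mpol) \<subseteq> Mon N" using i(2) by (simp add: Mon_def)
      then show "keys g \<subseteq> Mon N"
        using keys_diff[of "single (single i 1) 1" "\<phi> i T"] \<phi>_keys[OF i(1,2) T] \<open>Mon n \<subseteq> Mon N\<close>
        unfolding i(3) by blast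
    qed
    have k2: "f \<in> ideal N (graph n N (\<lambda>i. \<phi> i T)) \<longleftrightarrow>
        (\<forall>x. mpoly_eval (\<lambda>i. if i < n then x i else mpoly_eval x (\<phi> i T)) f = 0)" if "keys f \<subseteq> Mon N" for f
      using that \<phi>_keys T \<open>n \<le> N\<close> by (intro ideal_graph_iff[OF inf]) auto
    show ?thesis unfolding separates_def le_inf_iff using k1 k2 by blast
  qed
  ultimately show ?thesis by (simp cong: conj_cong)
qed


subsection \<open>Zariski closure\<close>

text \<open>Closed sets are intersections of zero sets of single polynomial functions, so membership
  can be tested with one function at a time.\<close>

lemma in_zariski_closure_of:
  assumes "S \<subseteq> W"
  shows "x \<in> zariski s W closure_of S \<longleftrightarrow>
    x \<in> W \<and> (\<forall>p\<in>polynomial_functions s. (\<forall>y\<in>S. p y = 0) \<longrightarrow> p x = 0)"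
proof
  assume x: "x \<in> zariski s W closure_of S"
  have "p x = 0" if p: "p \<in> polynomial_functions s" "\<forall>y\<in>S. p y = 0" for p
  proof -
    have "closedin (zariski s W) {y \<in> W. p y = 0}"
      unfolding closedin_zariski using p(1) by (intro exI[of _ "{p}"]) auto
    then have "zariski s W closure_of S \<subseteq> {y \<in> W. p y = 0}"
      using p(2) assms by (intro closure_of_minimal) auto
    then show ?thesis using x by blast
  qed
  then show "x \<in> W \<and> (\<forall>p\<in>polynomial_functions s. (\<forall>y\<in>S. p y = 0) \<longrightarrow> p x = 0)"
    using closure_of_subset_topspace[of "zariski s W" S] x by auto
next
  assume x: "x \<in> W \<and> (\<forall>p\<in>polynomial_functions s. (\<forall>y\<in>S. p y = 0) \<longrightarrow> p x = 0)"
  have "\<exists>y\<in>S. y \<in> U" if U: "x \<in> U" "openin (zariski s W) U" for U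
  proof -
    obtain P where P: "P \<subseteq> polynomial_functions s" "U = W - {x \<in> W. \<forall>p\<in>P. p x = 0}"
      using U(2) unfolding openin_zariski by blast
    then obtain p where "p \<in> P" "p x \<noteq> 0" using U(1) by blast
    then obtain y where "y \<in> S" "p y \<noteq> 0" using x P(1) by blast
    then show ?thesis using P(2) \<open>p \<in> P\<close> assms by blast
  qed
  then show "x \<in> zariski s W closure_of S" unfolding in_closure_of using x by auto
qed


subsection \<open>Coordinates on tensor spaces\<close>

text \<open>The index type is left open because there are two uses: the spaces \<open>V i\<close>,
  indexed by their own basis vectors, and K^r, indexed by \<open>{1..r}\<close>.\<close>

locale dual_bases =
  fixes s :: "'k::field \<Rightarrow> 'v::ab_group_add \<Rightarrow> 'v" and d :: nat and V :: "nat \<Rightarrow> 'v set"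
    and I :: "nat \<Rightarrow> 'i set" and e :: "nat \<Rightarrow> 'i \<Rightarrow> 'v" and \<delta> :: "nat \<Rightarrow> 'i \<Rightarrow> 'v \<Rightarrow> 'k"
  assumes finite_I: "\<And>i. i \<in> {1..d} \<Longrightarrow> finite (I i)"
    and functional_dual: "\<And>i k. i \<in> {1..d} \<Longrightarrow> k \<in> I i \<Longrightarrow> functional s (\<delta> i k)"
    and expand: "\<And>i v. i \<in> {1..d} \<Longrightarrow> v \<in> V i \<Longrightarrow> v = (\<Sum>k\<in>I i. s (\<delta> i k v) (e i k))"
begin

lemma functional_expand:
  assumes "i \<in> {1..d}" "v \<in> V i" "functional s \<xi>"
  shows "\<xi> v = (\<Sum>k\<in>I i. \<xi> (e i k) * \<delta> i k v)"
proof -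
  interpret Vector_Spaces.linear s "(*)" \<xi> by fact
  have "\<xi> v = \<xi> (\<Sum>k\<in>I i. s (\<delta> i k v) (e i k))" using expand[OF assms(1,2)] by simp
  also have "\<dots> = (\<Sum>k\<in>I i. \<delta> i k v * \<xi> (e i k))" by (simp only: sum scale)
  finally show ?thesis by (simp add: mult.commute)
qed

lemma tensor_induct [consumes 1, case_names zero step]:
  assumes "T \<in> tensor_space s d V" "P 0"
    and "\<And>c v T. v \<in> (\<Pi>\<^sub>E i\<in>{1..d}. V i) \<Longrightarrow> P T \<Longrightarrow> P (fscale c (pure_tensor s d v) + T)"
  shows "P T"
proof -
  interpret F: vector_space "fscale :: 'k \<Rightarrow> ((nat \<Rightarrow> 'v \<Rightarrow> 'k) \<Rightarrow> 'k) \<Rightarrow> _"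
    by (rule vector_space_fscale)
  show ?thesis
    using assms(1) unfolding tensor_space_def
  proof (induction rule: F.span_induct_alt)
    case base
    show ?case by (rule assms(2))
  next
    case (step c x y)
    then obtain v where "v \<in> (\<Pi>\<^sub>E i\<in>{1..d}. V i)" "x = pure_tensor s d v" by blast
    then show ?case using assms(3) step by blast
  qed
qed

lemma tensor_nonlinear:
  assumes "T \<in> tensor_space s d V" "\<not> (\<forall>i\<in>{1..d}. functional s (\<xi> i))"
  shows "T \<xi> = 0"
  using assms(1) by (induction rule: tensor_induct) (use assms(2) in \<open>auto simp: pure_tensor_def\<close>)

text \<open>Both sides are linear in \<open>T\<close>; for a pure tensor, every vector is expanded
  and the product multiplied out.\<close>

lemma tensor_expand:
  assumes "T \<in> tensor_space s d V" and \<xi>: "\<forall>i\<in>{1..d}. functional s (\<xi> i)"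
  shows "T \<xi> = (\<Sum>\<beta>\<in>(\<Pi>\<^sub>E i\<in>{1..d}. I i). (\<Prod>i=1..d. \<xi> i (e i (\<beta> i))) * T (\<lambda>i. \<delta> i (\<beta> i)))"
  using assms(1)
proof (induction rule: tensor_induct)
  case (step c v T)
  let ?P = "\<Pi>\<^sub>E i\<in>{1..d}. I i"
  have "pure_tensor s d v \<xi> = (\<Prod>i=1..d. \<Sum>k\<in>I i. \<xi> i (e i k) * \<delta> i k (v i))"
    unfolding pure_tensor_def if_P[OF \<xi>]
  proof (rule prod.cong[OF refl])
    fix i assume i: "i \<in> {1..d}"
    show "\<xi> i (v i) = (\<Sum>k\<in>I i. \<xi> i (e i k) * \<delta> i k (v i))"
      using functional_expand[OF i PiE_mem[OF step(1) i]] \<xi> i by blast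
  qed
  also have "\<dots> = (\<Sum>\<beta>\<in>?P. \<Prod>i=1..d. \<xi> i (e i (\<beta> i)) * \<delta> i (\<beta> i) (v i))"
    by (rule prod_sum_PiE) (use finite_I in auto)
  also have "\<dots> = (\<Sum>\<beta>\<in>?P. (\<Prod>i=1..d. \<xi> i (e i (\<beta> i))) * pure_tensor s d v (\<lambda>i. \<delta> i (\<beta> i)))"
  proof (rule sum.cong[OF refl])
    fix \<beta> assume "\<beta> \<in> ?P"
    then have lin: "\<forall>i\<in>{1..d}. functional s (\<delta> i (\<beta> i))"
      using functional_dual by (auto dest: PiE_mem)
    show "(\<Prod>i=1..d. \<xi> i (e i (\<beta> i)) * \<delta> i (\<beta> i) (v i)) =
        (\<Prod>i=1..d. \<xi> i (e i (\<beta> i))) * pure_tensor s d v (\<lambda>i. \<delta> i (\<beta> i))"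
      unfolding pure_tensor_def if_P[OF lin] by (rule prod.distrib)
  qed
  finally have *: "pure_tensor s d v \<xi> =
    (\<Sum>\<beta>\<in>?P. (\<Prod>i=1..d. \<xi> i (e i (\<beta> i))) * pure_tensor s d v (\<lambda>i. \<delta> i (\<beta> i)))" .
  show ?case
    unfolding plus_fun_apply fscale_apply * step(2)
    by (simp only: sum_distrib_left sum.distrib[symmetric]) (simp add: algebra_simps)
qed simp

text \<open>Expanding the first slot alone writes the flattening of \<open>T\<close> as a product of
  two matrices with inner index in \<open>I 1\<close>, which bounds its rank.\<close>

lemma tensor_expand_first:
  assumes "T \<in> tensor_space s d V" and \<xi>: "\<forall>i\<in>{1..d}. functional s (\<xi> i)" and d: "1 \<le> d"
  shows "T \<xi> = (\<Sum>k\<in>I 1. \<xi> 1 (e 1 k) * T (\<xi>(1 := \<delta> 1 k)))"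
  using assms(1)
proof (induction rule: tensor_induct)
  case (step c v T)
  have d1: "1 \<in> {1..d}" using d by simp
  have rem: "pure_tensor s d v (\<xi>(1 := \<zeta>)) = \<zeta> (v 1) * (\<Prod>i\<in>{1..d} - {1}. \<xi> i (v i))"
    if "functional s \<zeta>" for \<zeta>
  proof -
    have "\<forall>i\<in>{1..d}. functional s ((\<xi>(1 := \<zeta>)) i)" using \<xi> that by simp
    then show ?thesis
      unfolding pure_tensor_def using d1 by (simp add: prod.remove[of _ 1])
  qed
  have "pure_tensor s d v \<xi> = \<xi> 1 (v 1) * (\<Prod>i\<in>{1..d} - {1}. \<xi> i (v i))"
    using rem[of "\<xi> 1"] \<xi> d1 by simp
  also have "\<xi> 1 (v 1) = (\<Sum>k\<in>I 1. \<xi> 1 (e 1 k) * \<delta> 1 k (v 1))"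
    using functional_expand[OF d1, of "v 1"] PiE_mem[OF step(1) d1] \<xi> d1 by blast
  also have "\<dots> * (\<Prod>i\<in>{1..d} - {1}. \<xi> i (v i)) =
      (\<Sum>k\<in>I 1. \<xi> 1 (e 1 k) * pure_tensor s d v (\<xi>(1 := \<delta> 1 k)))"
    using rem functional_dual[OF d1] by (simp add: sum_distrib_right mult.assoc)
  finally have *: "pure_tensor s d v \<xi> =
      (\<Sum>k\<in>I 1. \<xi> 1 (e 1 k) * pure_tensor s d v (\<xi>(1 := \<delta> 1 k)))" .
  show ?case
    unfolding plus_fun_apply fscale_apply * step(2)
    by (simp only: sum_distrib_left sum.distrib[symmetric]) (simp add: algebra_simps)
qed simp

lemma tensor_sum:
  assumes T: "T \<in> tensor_space s d V"
  shows "T = (\<Sum>\<beta>\<in>(\<Pi>\<^sub>E i\<in>{1..d}. I i). fscale (T (\<lambda>i. \<delta> i (\<beta> i))) (pure_tensor s d (\<lambda>i. e i (\<beta> i))))"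
proof
  fix \<xi>
  have sum_apply: "(\<Sum>\<beta>\<in>K. f \<beta>) \<xi> = (\<Sum>\<beta>\<in>K. f \<beta> \<xi>)"
    for f :: "(nat \<Rightarrow> 'i) \<Rightarrow> (nat \<Rightarrow> 'v \<Rightarrow> 'k) \<Rightarrow> 'k" and K
    by (induction K rule: infinite_finite_induct) auto
  show "T \<xi> = (\<Sum>\<beta>\<in>(\<Pi>\<^sub>E i\<in>{1..d}. I i).
      fscale (T (\<lambda>i. \<delta> i (\<beta> i))) (pure_tensor s d (\<lambda>i. e i (\<beta> i)))) \<xi>"
  proof (cases "\<forall>i\<in>{1..d}. functional s (\<xi> i)")
    case True
    then show ?thesis
      unfolding sum_apply using tensor_expand[OF T True]
      by (simp add: pure_tensor_def mult.commute)
  next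
    case False
    then show ?thesis
      unfolding sum_apply tensor_nonlinear[OF T False]
      by (simp only: pure_tensor_def if_not_P[OF False] if_False fscale_apply mult_zero_right sum.neutral_const)
  qed
qed

end

text \<open>Serves for vectors of K^r and for tensors alike: a tensor is a function of tuples of
  functionals, so evaluating it at a fixed tuple is linear in the tensor.\<close>

lemma functional_coordinate: "functional fscale (\<lambda>x. x k)"
  by (simp add: Vector_Spaces.linear_iff vector_space_fscale vector_space_times)

interpretation coord_space: dual_bases "fscale :: 'k::field \<Rightarrow> _" d "\<lambda>_. coord_space r"
  "\<lambda>_. {1..r}" "\<lambda>_. unit_vec" "\<lambda>_ k x. x k" for d r
proof (rule dual_bases.intro)
  fix v :: "nat \<Rightarrow> 'k" assume v: "v \<in> coord_space r"
  show "v = (\<Sum>k\<in>{1..r}. fscale (v k) (unit_vec k))"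
  proof
    fix i
    have "(\<Sum>k\<in>K. fscale (v k) (unit_vec k)) i = (\<Sum>k\<in>K. if k = i then v k else 0)" for K
      by (induction K rule: infinite_finite_induct) (auto simp: unit_vec_def)
    then show "v i = (\<Sum>k\<in>{1..r}. fscale (v k) (unit_vec k)) i"
      using v by (auto simp: coord_space_def)
  qed
qed (simp, rule functional_coordinate)

lemma finite_dimensional_dual_basis:
  fixes s :: "'k::field \<Rightarrow> 'v::ab_group_add \<Rightarrow> 'v"
  assumes "vector_space s" "finite_dimensional s V"
  shows "\<exists>B \<delta>. finite B \<and> \<not> module.dependent s B \<and> V \<subseteq> module.span s B \<and>
    (\<forall>b\<in>B. functional s (\<delta> b)) \<and> (\<forall>v\<in>V. v = (\<Sum>b\<in>B. s (\<delta> b v) b))"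
proof -
  interpret D: vector_space_pair s "(*) :: 'k \<Rightarrow> 'k \<Rightarrow> 'k"
    by (rule vector_space_pair.intro[OF assms(1) vector_space_times])
  obtain C where C: "finite C" "C \<subseteq> V" "V \<subseteq> D.vs1.span C"
    using assms(2) unfolding finite_dimensional_def by blast
  obtain B where B: "B \<subseteq> V" "D.vs1.independent B" "V \<subseteq> D.vs1.span B"
    by (rule D.vs1.maximal_independent_subset[of V]) blast
  have fin: "finite B"
    using D.vs1.independent_span_bound[OF C(1) B(2)] B(1) C(3) by blast
  define \<delta> where "\<delta> b = D.construct B (\<lambda>x. if x = b then 1 else 0)" for b
  have lin: "functional s (\<delta> b)" for b
    unfolding \<delta>_def by (rule D.linear_construct[OF B(2)])
  have val: "\<delta> b x = (if x = b then 1 else 0)" if "x \<in> B" for b x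
    unfolding \<delta>_def by (rule D.construct_basis[OF B(2) that])
  have "v = (\<Sum>b\<in>B. s (\<delta> b v) b)" if "v \<in> V" for v
  proof -
    have "v \<in> D.vs1.span B" using that B(3) by blast
    then show ?thesis
    proof (induction rule: D.vs1.span_induct_alt)
      case base
      have "\<delta> b 0 = 0" for b using D.linear_0[OF lin] .
      then show ?case by simp
    next
      case (step c x y)
      have "\<delta> b (s c x + y) = c * \<delta> b x + \<delta> b y" for b
        using D.linear_add[OF lin] D.linear_scale[OF lin] by simp
      moreover have "(\<Sum>b\<in>B. s (c * \<delta> b x) b) = s c x"
      proof -
        have "(\<Sum>b\<in>B. s (c * \<delta> b x) b) = (\<Sum>b\<in>B. if b = x then s c b else 0)"
          using val[OF step(1)] by (intro sum.cong) auto
        then show ?thesis using step(1) fin by simp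
      qed
      ultimately show ?case
        using step(2) by (simp add: D.vs1.scale_left_distrib sum.distrib)
    qed
  qed
  then show ?thesis using fin B(2,3) lin by (intro exI[of _ B] exI[of _ \<delta>] conjI) auto
qed


subsection \<open>Vanishing of minors\<close>

text \<open>The even and the odd permutations are paired because of characteristic 2.\<close>

lemma sum_permutations_identical_columns:
  fixes C :: "nat \<Rightarrow> nat \<Rightarrow> 'k::comm_ring_1"
  assumes fin: "finite S" and ij: "i \<in> S" "j \<in> S" "i \<noteq> j" and eq: "C i = C j"
  shows "(\<Sum>p | p permutes S. of_int (sign p) * (\<Prod>k\<in>S. C k (p k))) = 0"
proof -
  let ?t = "transpose i j"
  let ?f = "\<lambda>p. of_int (sign p) * (\<Prod>k\<in>S. C k (p k)) :: 'k"
  have t: "?t permutes S" using ij by (intro permutes_swap_id)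
  have perm: "permutation p" if "p permutes S" for p
    using permutes_imp_permutation[OF fin that] .
  have tt: "p \<circ> ?t \<circ> ?t = p" for p :: "nat \<Rightarrow> nat" by (simp add: fun_eq_iff)
  have swap: "?f (p \<circ> ?t) = - ?f p" if p: "p permutes S" for p
  proof -
    have "(\<Prod>k\<in>S. C k (p k)) = (\<Prod>k\<in>S. C (?t k) (p (?t k)))"
      using prod.permute[OF t, of "\<lambda>k. C k (p k)"] by (simp add: o_def)
    also have "\<dots> = (\<Prod>k\<in>S. C k ((p \<circ> ?t) k))"
      by (intro prod.cong refl) (auto simp: transpose_def eq)
    finally show ?thesis
      using sign_compose[OF perm[OF p] perm[OF t]] ij(3) by (simp add: sign_swap_id)
  qed
  have bij: "bij_betw (\<lambda>p. p \<circ> ?t) {p. p permutes S \<and> evenperm p} {p. p permutes S \<and> \<not> evenperm p}"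
  proof (rule bij_betwI[where g = "\<lambda>p. p \<circ> ?t"])
    show "(\<lambda>p. p \<circ> ?t) \<in> {p. p permutes S \<and> evenperm p} \<rightarrow> {p. p permutes S \<and> \<not> evenperm p}"
      "(\<lambda>p. p \<circ> ?t) \<in> {p. p permutes S \<and> \<not> evenperm p} \<rightarrow> {p. p permutes S \<and> evenperm p}"
      using permutes_compose[OF t] evenperm_comp[OF perm perm[OF t]] ij(3)
      by (auto simp: evenperm_swap)
  qed (use tt in auto)
  have "(\<Sum>p | p permutes S. ?f p) =
      (\<Sum>p\<in>{p. p permutes S \<and> evenperm p} \<union> {p. p permutes S \<and> \<not> evenperm p}. ?f p)"
    by (intro sum.cong) auto
  also have "\<dots> = (\<Sum>p | p permutes S \<and> evenperm p. ?f p) + (\<Sum>p | p permutes S \<and> \<not> evenperm p. ?f p)"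
    using finite_permutations[OF fin] by (intro sum.union_disjoint) auto
  also have "(\<Sum>p | p permutes S \<and> \<not> evenperm p. ?f p) = (\<Sum>p | p permutes S \<and> evenperm p. ?f (p \<circ> ?t))"
    by (rule sum.reindex_bij_betw[OF bij, symmetric])
  also have "\<dots> = - (\<Sum>p | p permutes S \<and> evenperm p. ?f p)"
    unfolding sum_negf[symmetric] by (intro sum.cong) (use swap in auto)
  finally show ?thesis by simp
qed

text \<open>Multiplying out turns the Leibniz sum into a combination of determinants indexed by maps
  \<open>L\<close> from \<open>S\<close> to \<open>B\<close>. No such map is injective, so each of
  these determinants repeats a row of \<open>C\<close> and vanishes.\<close>

lemma determinant_factor_0:
  fixes A :: "nat \<Rightarrow> 'b \<Rightarrow> 'k::comm_ring_1"
  assumes fin: "finite S" "finite B" and card: "card B < card S"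
    and M: "\<And>j k. j \<in> S \<Longrightarrow> k \<in> S \<Longrightarrow> M j k = (\<Sum>b\<in>B. A j b * C b k)"
  shows "(\<Sum>p | p permutes S. of_int (sign p) * (\<Prod>j\<in>S. M j (p j))) = 0"
proof -
  have "(\<Prod>j\<in>S. M j (p j)) = (\<Sum>L\<in>(\<Pi>\<^sub>E j\<in>S. B). \<Prod>j\<in>S. A j (L j) * C (L j) (p j))"
    if "p permutes S" for p
  proof -
    have "(\<Prod>j\<in>S. M j (p j)) = (\<Prod>j\<in>S. \<Sum>b\<in>B. A j b * C b (p j))"
      using M permutes_in_image[OF that] by (intro prod.cong) auto
    also have "\<dots> = (\<Sum>L\<in>(\<Pi>\<^sub>E j\<in>S. B). \<Prod>j\<in>S. A j (L j) * C (L j) (p j))"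
      by (rule prod_sum_PiE) (use fin in auto)
    finally show ?thesis .
  qed
  then have "(\<Sum>p | p permutes S. of_int (sign p) * (\<Prod>j\<in>S. M j (p j))) =
      (\<Sum>p | p permutes S. \<Sum>L\<in>(\<Pi>\<^sub>E j\<in>S. B).
        of_int (sign p) * (\<Prod>j\<in>S. A j (L j) * C (L j) (p j)))"
    by (simp add: sum_distrib_left)
  also have "\<dots> = (\<Sum>L\<in>(\<Pi>\<^sub>E j\<in>S. B). (\<Prod>j\<in>S. A j (L j)) *
      (\<Sum>p | p permutes S. of_int (sign p) * (\<Prod>j\<in>S. C (L j) (p j))))"
    by (subst sum.swap) (simp add: sum_distrib_left prod.distrib ac_simps)
  also have "\<dots> = 0"
  proof (rule sum.neutral, rule ballI)
    fix L assume L: "L \<in> (\<Pi>\<^sub>E j\<in>S. B)"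
    then have "\<not> inj_on L S"
      using card card_inj_on_le[of L S B] fin(2) by (fastforce dest: PiE_mem)
    then obtain i j where "i \<in> S" "j \<in> S" "i \<noteq> j" "L i = L j" by (auto simp: inj_on_def)
    then have "(\<Sum>p | p permutes S. of_int (sign p) * (\<Prod>j\<in>S. C (L j) (p j))) = 0"
      by (intro sum_permutations_identical_columns[OF fin(1), where C = "\<lambda>j. C (L j)" and i = i and j = j])
        auto
    then show "(\<Prod>j\<in>S. A j (L j)) *
      (\<Sum>p | p permutes S. of_int (sign p) * (\<Prod>j\<in>S. C (L j) (p j))) = 0" by simp
  qed
  finally show ?thesis .
qed

lemma determinant_identity:
  assumes fin: "finite S" and M: "\<And>j k. j \<in> S \<Longrightarrow> k \<in> S \<Longrightarrow> M j k = (if j = k then 1 else 0)"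
  shows "(\<Sum>p | p permutes S. of_int (sign p) * (\<Prod>j\<in>S. M j (p j))) = (1 :: 'k::comm_ring_1)"
proof -
  have "of_int (sign p) * (\<Prod>j\<in>S. M j (p j)) = (if p = id then 1 else 0)" if p: "p permutes S" for p
  proof (cases "p = id")
    case True
    then show ?thesis using M by simp
  next
    case False
    then obtain j where j: "p j \<noteq> j" by (auto simp: fun_eq_iff)
    then have "j \<in> S" using p by (auto simp: permutes_def)
    then have "M j (p j) = 0" using M[of j "p j"] permutes_in_image[OF p] j by auto
    then have "(\<Prod>j\<in>S. M j (p j)) = 0" using \<open>j \<in> S\<close> fin by (auto intro: prod_zero)
    then show ?thesis using False by simp
  qed
  then have "(\<Sum>p | p permutes S. of_int (sign p) * (\<Prod>j\<in>S. M j (p j))) =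
      (\<Sum>p | p permutes S. if p = id then 1 else 0)" by (intro sum.cong) auto
  also have "\<dots> = 1" using finite_permutations[OF fin] permutes_id[of S] by simp
  finally show ?thesis .
qed


section \<open>Polynomial functions of a tensor in terms of its coordinates\<close>

lemma mon_eval_sum: "mon_eval y (\<Sum>i\<in>I. u i) = (\<Prod>i\<in>I. mon_eval y (u i))"
  by (induction I rule: infinite_finite_induct) (auto simp: mon_eval_add)

lemma Mon_sum: "(\<And>i. i \<in> I \<Longrightarrow> u i \<in> Mon N) \<Longrightarrow> (\<Sum>i\<in>I. u i) \<in> Mon N"
  by (induction I rule: infinite_finite_induct) auto

lemma mpoly_eval_polynomial_function:
  assumes "\<And>i. (\<lambda>T. y T i) \<in> polynomial_functions s"
  shows "(\<lambda>T. mpoly_eval (y T) f) \<in> polynomial_functions s"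
proof -
  have "(\<lambda>T. y T i ^ k) \<in> polynomial_functions s" for i k
    by (induction k) (auto intro: polynomial_functions.const polynomial_functions.mult assms)
  then show ?thesis
    unfolding mpoly_eval_def mon_eval_def
    by (intro polynomial_functions_sum polynomial_functions.mult polynomial_functions.const
        polynomial_functions_prod)
qed

lemma vars_between:
  assumes "keys f \<subseteq> Mon N \<inter> no_low n" "u \<in> keys f" "i \<in> keys u"
  shows "n \<le> i \<and> i < N"
proof -
  have "keys u \<subseteq> {..<N}" "\<forall>i<n. i \<notin> keys u"
    using assms(1,2) by (auto simp: Mon_def no_low_def in_keys_iff)
  then show ?thesis using assms(3) by (meson lessThan_iff not_le subsetD)
qed

text \<open>By \<open>tensor_sum\<close>, a linear functional is determined on the tensor space by
  its values on the pure tensors of the \<open>e i\<close>; sums and products follow. Variables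
  start at \<open>n\<close> to leave the lower ones to the source of the graph.\<close>

lemma (in dual_bases) polynomial_function_as_mpol:
  assumes bij: "bij_betw \<beta> {n..<N} (\<Pi>\<^sub>E i\<in>{1..d}. I i)"
    and p: "p \<in> polynomial_functions fscale"
  shows "\<exists>f. keys f \<subseteq> Mon N \<inter> no_low n \<and> (\<forall>T\<in>tensor_space s d V. \<forall>y.
      (\<forall>i\<in>{n..<N}. y i = T (\<lambda>j. \<delta> j (\<beta> i j))) \<longrightarrow> mpoly_eval y f = p T)"
  using p
proof induction
  case (const c)
  show ?case by (rule exI[of _ "single 0 c"]) (auto simp: no_low_def)
next
  case (linear l)
  interpret l: Vector_Spaces.linear fscale "(*)" l by fact
  define c where "c i = l (pure_tensor s d (\<lambda>j. e j (\<beta> i j)))" for i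
  define f where "f = (\<Sum>i\<in>{n..<N}. single (single i (1::nat)) (c i))"
  have "keys f \<subseteq> (\<Union>i\<in>{n..<N}. keys (single (single i (1::nat)) (c i)))"
    unfolding f_def by (rule keys_sum)
  also have "\<dots> \<subseteq> Mon N \<inter> no_low n"
    by (auto simp: Mon_def no_low_def lookup_single when_def)
  finally have "keys f \<subseteq> Mon N \<inter> no_low n" .
  moreover have "mpoly_eval y f = l T"
    if T: "T \<in> tensor_space s d V" and y: "\<forall>i\<in>{n..<N}. y i = T (\<lambda>j. \<delta> j (\<beta> i j))" for T y
  proof -
    have "l T = l (\<Sum>\<gamma>\<in>(\<Pi>\<^sub>E i\<in>{1..d}. I i).
        fscale (T (\<lambda>i. \<delta> i (\<gamma> i))) (pure_tensor s d (\<lambda>i. e i (\<gamma> i))))"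
      using tensor_sum[OF T] by (rule arg_cong)
    also have "\<dots> = (\<Sum>\<gamma>\<in>(\<Pi>\<^sub>E i\<in>{1..d}. I i).
        T (\<lambda>i. \<delta> i (\<gamma> i)) * l (pure_tensor s d (\<lambda>i. e i (\<gamma> i))))"
      by (simp only: l.sum l.scale)
    also have "\<dots> = (\<Sum>i\<in>{n..<N}. T (\<lambda>j. \<delta> j (\<beta> i j)) * c i)"
      unfolding c_def by (rule sum.reindex_bij_betw[OF bij, symmetric])
    also have "\<dots> = mpoly_eval y f"
      unfolding f_def mpoly_eval_sum using y by (intro sum.cong) (auto simp: mult.commute)
    finally show ?thesis by simp
  qed
  ultimately show ?case by blast
next
  case (add p q)
  then obtain f g where f: "keys f \<subseteq> Mon N \<inter> no_low n" "\<forall>T\<in>tensor_space s d V. \<forall>y.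
      (\<forall>i\<in>{n..<N}. y i = T (\<lambda>j. \<delta> j (\<beta> i j))) \<longrightarrow> mpoly_eval y f = p T"
    and g: "keys g \<subseteq> Mon N \<inter> no_low n" "\<forall>T\<in>tensor_space s d V. \<forall>y.
      (\<forall>i\<in>{n..<N}. y i = T (\<lambda>j. \<delta> j (\<beta> i j))) \<longrightarrow> mpoly_eval y g = q T"
    by blast
  have "keys (f + g) \<subseteq> Mon N \<inter> no_low n" using f(1) g(1) keys_add[of f g] by blast
  then show ?case using f(2) g(2) by (intro exI[of _ "f + g"]) (simp add: mpoly_eval_add)
next
  case (mult p q)
  then obtain f g where f: "keys f \<subseteq> Mon N \<inter> no_low n" "\<forall>T\<in>tensor_space s d V. \<forall>y.
      (\<forall>i\<in>{n..<N}. y i = T (\<lambda>j. \<delta> j (\<beta> i j))) \<longrightarrow> mpoly_eval y f = p T"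
    and g: "keys g \<subseteq> Mon N \<inter> no_low n" "\<forall>T\<in>tensor_space s d V. \<forall>y.
      (\<forall>i\<in>{n..<N}. y i = T (\<lambda>j. \<delta> j (\<beta> i j))) \<longrightarrow> mpoly_eval y g = q T"
    by blast
  have "keys (f * g) \<subseteq> Mon N \<inter> no_low n" using f(1) g(1) keys_mult[of f g] by fastforce
  then show ?case using f(2) g(2) by (intro exI[of _ "f * g"]) (simp add: mpoly_eval_mult)
qed

lemma pure_tensor_in_tensor_space:
  fixes s :: "'k::field \<Rightarrow> 'v::ab_group_add \<Rightarrow> 'v"
  assumes "\<And>i. i \<in> {1..d} \<Longrightarrow> v i \<in> V i"
  shows "pure_tensor s d v \<in> tensor_space s d V"
proof -
  interpret F: vector_space "fscale :: 'k \<Rightarrow> ((nat \<Rightarrow> 'v \<Rightarrow> 'k) \<Rightarrow> 'k) \<Rightarrow> _"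
    by (rule vector_space_fscale)
  have "pure_tensor s d v = pure_tensor s d (restrict v {1..d})"
    by (auto simp: pure_tensor_def fun_eq_iff intro!: prod.cong)
  moreover have "restrict v {1..d} \<in> (\<Pi>\<^sub>E i\<in>{1..d}. V i)" using assms by auto
  ultimately show ?thesis unfolding tensor_space_def by (auto intro!: F.span_base)
qed

lemma unit_tensor_in_tensor_space:
  "unit_tensor d r \<in> tensor_space fscale d (\<lambda>_. coord_space r :: (nat \<Rightarrow> 'k::field) set)"
proof -
  interpret F: vector_space "fscale :: 'k \<Rightarrow> ((nat \<Rightarrow> (nat \<Rightarrow> 'k) \<Rightarrow> 'k) \<Rightarrow> 'k) \<Rightarrow> _"
    by (rule vector_space_fscale)
  have "pure_tensor fscale d (\<lambda>_. unit_vec i) \<in> tensor_space fscale d (\<lambda>_. coord_space r :: (nat \<Rightarrow> 'k) set)"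
    if "i \<in> {1..r}" for i
    using that by (intro pure_tensor_in_tensor_space) (auto simp: coord_space_def unit_vec_def)
  then show ?thesis
    unfolding unit_tensor_def tensor_space_def by (intro F.span_sum)
qed

section \<open>Degenerations in coordinates and the flattening bound\<close>

context dual_bases
begin

abbreviation admissible :: "nat \<Rightarrow> (nat \<Rightarrow> 'v \<Rightarrow> nat \<Rightarrow> 'k) \<Rightarrow> bool" where
  "admissible r \<phi> \<equiv> \<forall>i\<in>{1..d}. Vector_Spaces.linear s fscale (\<phi> i) \<and> \<phi> i ` V i \<subseteq> coord_space r"

lemma tensor_map_in_tensor_space:
  assumes "admissible r \<phi>" "T \<in> tensor_space s d V"
  shows "tensor_map fscale d \<phi> T \<in> tensor_space fscale d (\<lambda>_. coord_space r)"
proof -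
  interpret F: vector_space "fscale :: 'k \<Rightarrow> ((nat \<Rightarrow> (nat \<Rightarrow> 'k) \<Rightarrow> 'k) \<Rightarrow> 'k) \<Rightarrow> _"
    by (rule vector_space_fscale)
  interpret L: Vector_Spaces.linear fscale fscale
    "tensor_map fscale d \<phi> :: ((nat \<Rightarrow> 'v \<Rightarrow> 'k) \<Rightarrow> 'k) \<Rightarrow> (nat \<Rightarrow> (nat \<Rightarrow> 'k) \<Rightarrow> 'k) \<Rightarrow> 'k"
    by (rule linear_tensor_map)
  show ?thesis
    using assms(2)
  proof (induction rule: tensor_induct)
    case zero
    show ?case unfolding L.zero tensor_space_def by (rule F.span_zero)
  next
    case (step c v T)
    have "tensor_map fscale d \<phi> (pure_tensor s d v) = pure_tensor fscale d (\<lambda>i. \<phi> i (v i))"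
      using assms(1) by (intro tensor_map_pure_tensor) blast
    also have "\<dots> \<in> tensor_space fscale d (\<lambda>_. coord_space r)"
      using assms(1) PiE_mem[OF step(1)] by (intro pure_tensor_in_tensor_space) blast
    finally show ?case
      using step(2) unfolding L.add L.scale tensor_space_def
      by (intro F.span_add F.span_scale)
  qed
qed

lemma in_degenerations_iff:
  assumes "T \<in> tensor_space s d V"
  shows "unit_tensor d r \<in> degenerations s d V r T \<longleftrightarrow>
    (\<forall>p\<in>polynomial_functions fscale.
      (\<forall>\<phi>. admissible r \<phi> \<longrightarrow> p (tensor_map fscale d \<phi> T) = 0) \<longrightarrow> p (unit_tensor d r) = 0)"
proof -
  have "{tensor_map fscale d \<phi> T | \<phi>. admissible r \<phi>} \<subseteq> tensor_space fscale d (\<lambda>_. coord_space r)"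
    using tensor_map_in_tensor_space assms by blast
  from in_zariski_closure_of[OF this, of "unit_tensor d r" fscale] show ?thesis
    unfolding degenerations_def using unit_tensor_in_tensor_space[of d r, where 'k='k] by blast
qed

lemma tensor_map_functional_eq:
  assumes "admissible r \<phi>" "\<forall>i\<in>{1..d}. functional fscale (\<eta> i)"
  shows "tensor_map fscale d \<phi> T \<eta> = T (\<lambda>i. \<eta> i \<circ> \<phi> i)"
    and "\<forall>i\<in>{1..d}. functional s (\<eta> i \<circ> \<phi> i)"
proof -
  show "tensor_map fscale d \<phi> T \<eta> = T (\<lambda>i. \<eta> i \<circ> \<phi> i)"
    unfolding tensor_map_def if_P[OF assms(2)] ..
  show "\<forall>i\<in>{1..d}. functional s (\<eta> i \<circ> \<phi> i)"
    using assms by (blast intro: Vector_Spaces.linear_compose)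
qed

text \<open>For fixed \<open>J\<close> the right-hand side is a polynomial in the matrix entries of
  the maps, with coefficients linear in \<open>T\<close>; the graph equations are read off from
  it.\<close>

lemma tensor_map_coordinate:
  assumes "admissible r \<phi>" "T \<in> tensor_space s d V"
  shows "tensor_map fscale d \<phi> T (\<lambda>i x. x (J i)) =
    (\<Sum>\<gamma>\<in>(\<Pi>\<^sub>E i\<in>{1..d}. I i). (\<Prod>i=1..d. \<phi> i (e i (\<gamma> i)) (J i)) * T (\<lambda>i. \<delta> i (\<gamma> i)))"
proof -
  have f: "\<forall>i\<in>{1..d}. functional fscale ((\<lambda>i x. x (J i)) i)"
    by (simp add: functional_coordinate)
  note eq = tensor_map_functional_eq[OF assms(1) f]
  show ?thesis
    unfolding eq(1) tensor_expand[OF assms(2) eq(2)] by simp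
qed

lemma unit_tensor_degeneration_bound:
  assumes d: "d \<ge> 2" and T: "T \<in> tensor_space s d V"
    and deg: "unit_tensor d r \<in> degenerations s d V r T"
  shows "r \<le> card (I 1)"
proof (rule ccontr)
  assume "\<not> r \<le> card (I 1)"
  then have card: "card (I 1) < card {1..r}" by simp
  \<comment> \<open>\<open>j\<close> is read off in the first slot and \<open>k\<close> in all
    others, which selects an \<open>r\<close> by \<open>r\<close> block of the flattening. On the
    unit tensor it is the identity matrix, as \<open>d \<ge> 2\<close> makes both indices
    occur.\<close>
  define \<eta> :: "nat \<Rightarrow> nat \<Rightarrow> nat \<Rightarrow> (nat \<Rightarrow> 'k) \<Rightarrow> 'k"
    where "\<eta> j k i = (if i = 1 then (\<lambda>x. x j) else (\<lambda>x. x k))" for j k i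
  define p where "p T' = (\<Sum>\<pi> | \<pi> permutes {1..r}. of_int (sign \<pi>) * (\<Prod>j\<in>{1..r}. T' (\<eta> j (\<pi> j))))"
    for T' :: "(nat \<Rightarrow> (nat \<Rightarrow> 'k) \<Rightarrow> 'k) \<Rightarrow> 'k"
  have lin: "\<forall>i\<in>{1..d}. functional fscale (\<eta> j k i)" for j k
    by (simp add: \<eta>_def functional_coordinate)
  have "p \<in> polynomial_functions fscale"
    unfolding p_def
    by (intro polynomial_functions_sum polynomial_functions.mult polynomial_functions.const
        polynomial_functions_prod polynomial_functions.linear functional_coordinate)
  moreover have "p (tensor_map fscale d \<phi> T) = 0" if adm: "admissible r \<phi>" for \<phi>
    unfolding p_def
  proof (rule determinant_factor_0[where M = "\<lambda>j k. tensor_map fscale d \<phi> T (\<eta> j k)"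
        and A = "\<lambda>j b. \<phi> 1 (e 1 b) j" and B = "I 1"
        and C = "\<lambda>b k. T ((\<lambda>i. (\<lambda>x. x k) \<circ> \<phi> i)(1 := \<delta> 1 b))"])
    show "finite (I 1)" using finite_I d by simp
    fix j k
    note eq = tensor_map_functional_eq[OF adm lin]
    have "(\<lambda>i. \<eta> j k i \<circ> \<phi> i)(1 := \<zeta>) = (\<lambda>i. (\<lambda>x. x k) \<circ> \<phi> i)(1 := \<zeta>)" for \<zeta>
      by (auto simp: \<eta>_def)
    then show "tensor_map fscale d \<phi> T (\<eta> j k) =
        (\<Sum>b\<in>I 1. \<phi> 1 (e 1 b) j * T ((\<lambda>i. (\<lambda>x. x k) \<circ> \<phi> i)(1 := \<delta> 1 b)))"
      unfolding eq(1) using tensor_expand_first[OF T eq(2)] d by (simp add: \<eta>_def)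
  qed (use card in auto)
  moreover have "p (unit_tensor d r) = 1"
    unfolding p_def
  proof (rule determinant_identity[where M = "\<lambda>j k. unit_tensor d r (\<eta> j k)"])
    fix j k :: nat assume jk: "j \<in> {1..r}" "k \<in> {1..r}"
    have sum_apply: "(\<Sum>i\<in>K. f i) \<xi> = (\<Sum>i\<in>K. f i \<xi>)"
      for f :: "nat \<Rightarrow> (nat \<Rightarrow> (nat \<Rightarrow> 'k) \<Rightarrow> 'k) \<Rightarrow> 'k" and K \<xi>
      by (induction K rule: infinite_finite_induct) auto
    have "unit_tensor d r (\<eta> j k) = (\<Sum>i=1..r. \<Prod>l=1..d. \<eta> j k l (unit_vec i))"
      unfolding unit_tensor_def sum_apply pure_tensor_def if_P[OF lin] ..
    also have "\<dots> = (\<Sum>i=1..r. if i = j then (if j = k then 1 else 0) else 0)"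
    proof (rule sum.cong[OF refl])
      fix i
      show "(\<Prod>l=1..d. \<eta> j k l (unit_vec i)) = (if i = j then (if j = k then 1 else 0) else 0)"
      proof (cases "i = j \<and> j = k")
        case True
        then show ?thesis by (auto simp: \<eta>_def unit_vec_def intro!: prod.neutral)
      next
        case False
        then have "\<eta> j k 1 (unit_vec i) = 0 \<or> \<eta> j k 2 (unit_vec i) = 0"
          by (auto simp: \<eta>_def unit_vec_def)
        then have "(\<Prod>l=1..d. \<eta> j k l (unit_vec i)) = 0"
          using d by (intro prod_zero) (auto intro: bexI[of _ 1] bexI[of _ 2])
        then show ?thesis using False by auto
      qed
    qed
    also have "\<dots> = (if j = k then 1 else 0)" using jk by simp
    finally show "unit_tensor d r (\<eta> j k) = (if j = k then 1 else 0)" .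
  qed simp
  ultimately show False
    using deg unfolding in_degenerations_iff[OF T] by force
qed

end

section \<open>The locus of tensors degenerating to a unit tensor, and the levels of border
  subrank\<close>

text \<open>The bound \<open>m\<close> turns the maximum into a finite Boolean combination of
  instances of \<open>P\<close>, as constructibility requires.\<close>

lemma Greatest_eq_iff:
  fixes P :: "nat \<Rightarrow> bool"
  assumes "P 0" "\<And>q. P q \<Longrightarrow> q \<le> m"
  shows "(GREATEST q. P q) = r \<longleftrightarrow> P r \<and> (\<forall>q\<in>{r<..m}. \<not> P q)"
proof -
  have P: "P (GREATEST q. P q)" by (rule GreatestI_nat[of P 0 m]) (use assms in auto)
  have le: "q \<le> (GREATEST q. P q)" if "P q" for q
    by (rule Greatest_le_nat[of P q m]) (use assms that in auto)
  show ?thesis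
  proof
    assume "(GREATEST q. P q) = r"
    then show "P r \<and> (\<forall>q\<in>{r<..m}. \<not> P q)" using P le by force
  next
    assume r: "P r \<and> (\<forall>q\<in>{r<..m}. \<not> P q)"
    then have "r \<le> (GREATEST q. P q)" using le by blast
    moreover have "\<not> r < (GREATEST q. P q)" using r P assms(2) by auto
    ultimately show "(GREATEST q. P q) = r" by simp
  qed
qed


text \<open>Separation asserts the existence of a polynomial, so the complement is treated first.
  Variables below \<open>n\<close> carry the matrix entries on the bases, those from
  \<open>n\<close> to \<open>N - 1\<close> the target coordinates.\<close>

lemma constructible_degenerating_to_unit_tensor:
  fixes s :: "'k::alg_closed_field \<Rightarrow> 'v::ab_group_add \<Rightarrow> 'v"
  assumes vs: "vector_space s"
    and src: "dual_bases s d V B (\<lambda>_ b. b) \<delta>"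
    and B: "\<And>i. i \<in> {1..d} \<Longrightarrow> \<not> module.dependent s (B i)"
      "\<And>i. i \<in> {1..d} \<Longrightarrow> V i \<subseteq> module.span s (B i)"
  shows "constructible_in (zariski fscale (tensor_space s d V))
           {T \<in> tensor_space s d V. unit_tensor d r \<in> degenerations s d V r T}"
proof -
  interpret src: dual_bases s d V B "\<lambda>_ b. b" \<delta> by (rule src)
  define W where "W = tensor_space s d V"
  define Q where "Q = (SIGMA i:{1..d}. {1..r} \<times> B i)"
  \<comment> \<open>\<open>Suc\<close> adds one spare variable, so that \<open>0 < N\<close> even
    when \<open>Q\<close> and \<open>J\<close> are empty, as for \<open>r = 0\<close> with
    \<open>d > 0\<close>.\<close>
  define n where "n = Suc (card Q)"
  define J where "J = (\<Pi>\<^sub>E i\<in>{1..d}. {1..r})"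
  define N where "N = n + card J"
  define \<Gamma> where "\<Gamma> = (\<Pi>\<^sub>E i\<in>{1..d}. B i)"
  have finQ: "finite Q" unfolding Q_def using src.finite_I by auto
  have finJ: "finite J" unfolding J_def by (intro finite_PiE) auto
  have fin\<Gamma>: "finite \<Gamma>" unfolding \<Gamma>_def using src.finite_I by (intro finite_PiE) auto
  obtain pos where pos: "bij_betw pos Q {0..<card Q}"
    using ex_bij_betw_finite_nat[OF finQ] by blast
  obtain \<beta> where \<beta>: "bij_betw \<beta> {n..<N} J"
    using finite_same_card_bij[of "{n..<N}" J] finJ by (auto simp: N_def)
  have \<beta>J: "\<beta> i j \<in> {1..r}" if "i \<in> {n..<N}" "j \<in> {1..d}" for i j
    using bij_betwE[OF \<beta>] that unfolding J_def by (blast dest: PiE_mem)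
  have inQ: "(j, \<beta> i j, \<gamma> j) \<in> Q" if "i \<in> {n..<N}" "j \<in> {1..d}" "\<gamma> \<in> \<Gamma>" for i j \<gamma>
    using \<beta>J[OF that(1,2)] that(2) PiE_mem[OF that(3)[unfolded \<Gamma>_def] that(2)]
    unfolding Q_def by simp
  have pos_less: "pos q < n" if "q \<in> Q" for q
    using bij_betwE[OF pos] that by (force simp: n_def)

  \<comment> \<open>The product of matrix entries that multiplies the coordinate of \<open>T\<close>
    at \<open>\<gamma>\<close> in \<open>tensor_map_coordinate\<close>.\<close>
  define mn where "mn i \<gamma> = (\<Sum>j=1..d. single (pos (j, \<beta> i j, \<gamma> j)) (1::nat))" for i \<gamma>
  define \<Phi> where "\<Phi> i T = (\<Sum>\<gamma>\<in>\<Gamma>. single (mn i \<gamma>) (T (\<lambda>j. \<delta> j (\<gamma> j))))"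
    for i and T :: "(nat \<Rightarrow> 'v \<Rightarrow> 'k) \<Rightarrow> 'k"
  have fam_\<Phi>: "\<exists>A. poly_family fscale n W A (\<Phi> i)" if i: "n \<le> i" "i < N" for i
  proof -
    have single: "poly_family fscale n W {mn i \<gamma>} (\<lambda>T. single (mn i \<gamma>) (T (\<lambda>j. \<delta> j (\<gamma> j))))" if "\<gamma> \<in> \<Gamma>" for \<gamma>
    proof (rule poly_family_single)
      show "mn i \<gamma> \<in> Mon n"
        unfolding mn_def using pos_less[OF inQ[of i _ \<gamma>]] i that
        by (intro Mon_sum) (auto simp: Mon_def)
      show "(\<lambda>T. T (\<lambda>j. \<delta> j (\<gamma> j))) \<in> polynomial_functions fscale"
        by (rule polynomial_functions.linear[OF functional_coordinate])
    qed
    show ?thesis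
      unfolding \<Phi>_def by (rule exI, rule poly_family_sum[OF fin\<Gamma>], rule single)
  qed

  \<comment> \<open>Every tuple of maps has a matching point and every point a matching admissible
    tuple, so vanishing at all points and vanishing on all images of \<open>T\<close> become
    equivalent.\<close>
  define matches where "matches x \<phi> \<longleftrightarrow> (\<forall>(i, k, b)\<in>Q. x (pos (i, k, b)) = \<phi> i b k)"
    for x :: "nat \<Rightarrow> 'k" and \<phi> :: "nat \<Rightarrow> 'v \<Rightarrow> nat \<Rightarrow> 'k"
  have coord: "tensor_map fscale d \<phi> T (\<lambda>j y. y (\<beta> i j)) = mpoly_eval x (\<Phi> i T)"
    if m: "matches x \<phi>" and adm: "src.admissible r \<phi>" and T: "T \<in> W" and i: "i \<in> {n..<N}" for x \<phi> T i
  proof -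
    have "x (pos (j, \<beta> i j, \<gamma> j)) = \<phi> j (\<gamma> j) (\<beta> i j)" if "\<gamma> \<in> \<Gamma>" "j \<in> {1..d}" for \<gamma> j
      using m inQ[OF i that(2,1)] unfolding matches_def by blast
    then have "mon_eval x (mn i \<gamma>) = (\<Prod>j=1..d. \<phi> j (\<gamma> j) (\<beta> i j))" if "\<gamma> \<in> \<Gamma>" for \<gamma>
      unfolding mn_def mon_eval_sum using that by (intro prod.cong) auto
    then show ?thesis
      unfolding src.tensor_map_coordinate[OF adm T[unfolded W_def]] \<Phi>_def mpoly_eval_sum \<Gamma>_def[symmetric]
      by (intro sum.cong) (auto simp: mult.commute)
  qed
  have ex_x: "\<exists>x. matches x \<phi>" for \<phi>
  proof -
    have "inv_into Q pos (pos q) = q" if "q \<in> Q" for q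
      using pos that by (simp add: bij_betw_def)
    then have "matches (\<lambda>t. case inv_into Q pos t of (i, k, b) \<Rightarrow> \<phi> i b k) \<phi>"
      unfolding matches_def by fastforce
    then show ?thesis by blast
  qed
  have ex_\<phi>: "\<exists>\<phi>. src.admissible r \<phi> \<and> matches x \<phi>" for x
  proof -
    interpret L: vector_space_pair s "fscale :: 'k \<Rightarrow> (nat \<Rightarrow> 'k) \<Rightarrow> _"
      by (rule vector_space_pair.intro[OF vs vector_space_fscale])
    \<comment> \<open>The entries prescribe values on the independent set \<open>B i\<close>, which
      extend linearly; cutting off outside \<open>{1..r}\<close> keeps the image of
      \<open>V i\<close> in \<open>coord_space r\<close>.\<close>
    define f where "f i b = (\<lambda>k. if k \<in> {1..r} then x (pos (i, k, b)) else 0)" for i b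
    have "\<forall>i\<in>{1..d}. \<exists>g. Vector_Spaces.linear s fscale g \<and> (\<forall>b\<in>B i. g b = f i b)"
      using L.linear_independent_extend[OF B(1)] by blast
    from bchoice[OF this] obtain \<phi> where
      \<phi>: "\<forall>i\<in>{1..d}. Vector_Spaces.linear s fscale (\<phi> i) \<and> (\<forall>b\<in>B i. \<phi> i b = f i b)"
      by (rule exE)
    have subc: "L.vs2.subspace (coord_space r)"
      unfolding L.vs2.subspace_def by (auto simp: coord_space_def)
    have "\<phi> i v \<in> coord_space r" if i: "i \<in> {1..d}" and v: "v \<in> V i" for i v
    proof -
      have lin: "Vector_Spaces.linear s fscale (\<phi> i)" using \<phi> i by blast
      have "v \<in> L.vs1.span (B i)" using B(2)[OF i] v by blast
      then have "\<phi> i v \<in> L.vs2.span (\<phi> i ` B i)"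
        unfolding L.linear_span_image[OF lin] by blast
      moreover have "\<phi> i ` B i \<subseteq> coord_space r"
        using \<phi> i by (auto simp: f_def coord_space_def)
      ultimately show ?thesis using L.vs2.span_minimal[OF _ subc] by blast
    qed
    then have "src.admissible r \<phi>" using \<phi> by blast
    moreover have "matches x \<phi>"
      unfolding matches_def Q_def using \<phi> by (auto simp: f_def)
    ultimately show ?thesis by blast
  qed

  \<comment> \<open>For \<open>i\<close> outside \<open>{n..<N}\<close> the value is arbitrary; the
    polynomials \<open>f\<close> below contain only variables from that range.\<close>
  define y where "y i = unit_tensor d r (\<lambda>j (v :: nat \<Rightarrow> 'k). v (\<beta> i j))" for i
  have char: "unit_tensor d r \<notin> degenerations s d V r T \<longleftrightarrow>
      (\<exists>f. keys f \<subseteq> Mon N \<inter> no_low n \<and> mpoly_eval y f \<noteq> 0 \<and>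
        (\<forall>x. mpoly_eval (\<lambda>i. if i < n then x i else mpoly_eval x (\<Phi> i T)) f = 0))" if T: "T \<in> W" for T
  proof
    assume "unit_tensor d r \<notin> degenerations s d V r T"
    then obtain p where p: "p \<in> polynomial_functions fscale" "p (unit_tensor d r) \<noteq> 0"
      "\<And>\<phi>. src.admissible r \<phi> \<Longrightarrow> p (tensor_map fscale d \<phi> T) = 0"
      unfolding src.in_degenerations_iff[OF T[unfolded W_def]] by blast
    obtain f where f: "keys f \<subseteq> Mon N \<inter> no_low n"
      "\<forall>T\<in>tensor_space fscale d (\<lambda>_. coord_space r). \<forall>y.
        (\<forall>i\<in>{n..<N}. y i = T (\<lambda>j v. v (\<beta> i j))) \<longrightarrow> mpoly_eval y f = p T"
      using coord_space.polynomial_function_as_mpol[OF \<beta>[unfolded J_def] p(1)] by blast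
    have "mpoly_eval y f = p (unit_tensor d r)"
      by (rule f(2)[rule_format, OF unit_tensor_in_tensor_space]) (simp add: y_def)
    moreover have "mpoly_eval (\<lambda>i. if i < n then x i else mpoly_eval x (\<Phi> i T)) f = 0" for x
    proof -
      obtain \<phi> where \<phi>: "src.admissible r \<phi>" "matches x \<phi>" using ex_\<phi> by blast
      have "mpoly_eval (\<lambda>i. if i < n then x i else mpoly_eval x (\<Phi> i T)) f = p (tensor_map fscale d \<phi> T)"
        by (rule f(2)[rule_format, OF src.tensor_map_in_tensor_space[OF \<phi>(1) T[unfolded W_def]]])
          (simp add: coord[OF \<phi>(2,1) T])
      then show ?thesis using p(3)[OF \<phi>(1)] by simp
    qed
    ultimately show "\<exists>f. keys f \<subseteq> Mon N \<inter> no_low n \<and> mpoly_eval y f \<noteq> 0 \<and>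
        (\<forall>x. mpoly_eval (\<lambda>i. if i < n then x i else mpoly_eval x (\<Phi> i T)) f = 0)"
      using f(1) p(2) by auto
  next
    assume "\<exists>f. keys f \<subseteq> Mon N \<inter> no_low n \<and> mpoly_eval y f \<noteq> 0 \<and>
        (\<forall>x. mpoly_eval (\<lambda>i. if i < n then x i else mpoly_eval x (\<Phi> i T)) f = 0)"
    then obtain f where f: "keys f \<subseteq> Mon N \<inter> no_low n" "mpoly_eval y f \<noteq> 0"
      "\<And>x. mpoly_eval (\<lambda>i. if i < n then x i else mpoly_eval x (\<Phi> i T)) f = 0" by blast
    define p where "p T' = mpoly_eval (\<lambda>i. T' (\<lambda>j (v :: nat \<Rightarrow> 'k). v (\<beta> i j))) f" for T'
    have "p \<in> polynomial_functions fscale"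
      unfolding p_def
      by (intro mpoly_eval_polynomial_function polynomial_functions.linear functional_coordinate)
    moreover have "p (unit_tensor d r) \<noteq> 0" using f(2) by (simp add: p_def y_def[abs_def])
    moreover have "p (tensor_map fscale d \<phi> T) = 0" if adm: "src.admissible r \<phi>" for \<phi>
    proof -
      obtain x where x: "matches x \<phi>" using ex_x by blast
      have "p (tensor_map fscale d \<phi> T) = mpoly_eval (\<lambda>i. if i < n then x i else mpoly_eval x (\<Phi> i T)) f"
        unfolding p_def
      proof (rule mpoly_eval_cong)
        fix u i assume "u \<in> keys f" "i \<in> keys u"
        then have "n \<le> i \<and> i < N" using vars_between[OF f(1)] by blast
        then show "tensor_map fscale d \<phi> T (\<lambda>j v. v (\<beta> i j)) = (if i < n then x i else mpoly_eval x (\<Phi> i T))"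
          using coord[OF x adm T] by auto
      qed
      then show ?thesis using f(3) by simp
    qed
    ultimately show "unit_tensor d r \<notin> degenerations s d V r T"
      unfolding src.in_degenerations_iff[OF T[unfolded W_def]] by blast
  qed
  have "constructible_in (zariski fscale W) {T \<in> W. \<exists>f. keys f \<subseteq> Mon N \<inter> no_low n \<and> mpoly_eval y f \<noteq> 0 \<and>
        (\<forall>x. mpoly_eval (\<lambda>i. if i < n then x i else mpoly_eval x (\<Phi> i T)) f = 0)}"
    by (rule constructible_separated_from_image[OF alg_closed_infinite])
      (use fam_\<Phi> in \<open>auto simp: N_def n_def\<close>)
  then have "constructible_in (zariski fscale W) {T \<in> W. unit_tensor d r \<notin> degenerations s d V r T}"
    using char by (simp cong: conj_cong)
  from constructible_in_compl[OF this] show ?thesis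
    unfolding topspace_zariski W_def[symmetric] by (rule back_subst) auto
qed

theorem proposition1p1:
  fixes s :: "'k::alg_closed_field \<Rightarrow> 'v::ab_group_add \<Rightarrow> 'v"
    and V :: "nat \<Rightarrow> 'v set"
    and d r :: nat
  assumes "vector_space s"
    and "d \<ge> 2"
    and "\<And>i. i \<in> {1..d} \<Longrightarrow> module.subspace s (V i)"
    and "\<And>i. i \<in> {1..d} \<Longrightarrow> finite_dimensional s (V i)"
  shows "constructible_in (zariski fscale (tensor_space s d V))
           {T \<in> tensor_space s d V. border_subrank s d V T = r} \<and>
         constructible_in (zariski fscale (tensor_space s d V))
           {T \<in> tensor_space s d V. border_subrank s d V T < r} \<and>
         constructible_in (zariski fscale (tensor_space s d V))
           {T \<in> tensor_space s d V. border_subrank s d V T \<ge> r}"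
proof -
  define W where "W = tensor_space s d V"
  define X where "X = zariski fscale W"
  define basis where "basis i p \<longleftrightarrow> finite (fst p) \<and> \<not> module.dependent s (fst p) \<and>
      V i \<subseteq> module.span s (fst p) \<and> (\<forall>b\<in>fst p. functional s (snd p b)) \<and>
      (\<forall>v\<in>V i. v = (\<Sum>b\<in>fst p. s (snd p b v) b))" for i p
  have "\<exists>p. basis i p" if i: "i \<in> {1..d}" for i
  proof -
    obtain B \<delta> where "basis i (B, \<delta>)"
      using finite_dimensional_dual_basis[OF assms(1) assms(4)[OF i]] unfolding basis_def fst_conv snd_conv
      by (elim exE)
    then show ?thesis by blast
  qed
  then have "\<forall>i\<in>{1..d}. \<exists>p. basis i p" by blast
  from bchoice[OF this] obtain p where p: "\<forall>i\<in>{1..d}. basis i (p i)" by (rule exE)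
  define B where "B i = fst (p i)" for i
  define \<delta> where "\<delta> i = snd (p i)" for i
  have basis: "finite (B i)" "\<not> module.dependent s (B i)" "V i \<subseteq> module.span s (B i)"
    "\<forall>b\<in>B i. functional s (\<delta> i b)" "\<forall>v\<in>V i. v = (\<Sum>b\<in>B i. s (\<delta> i b v) b)"
    if "i \<in> {1..d}" for i
    using p that unfolding basis_def B_def \<delta>_def by blast+
  have src: "dual_bases s d V B (\<lambda>_ b. b) \<delta>"
    by (rule dual_bases.intro) (use basis in blast)+
  interpret src: dual_bases s d V B "\<lambda>_ b. b" \<delta> by (rule src)

  define P where "P T q \<longleftrightarrow> unit_tensor d q \<in> degenerations s d V q T" for T q
  define A where "A q = {T \<in> W. P T q}" for q
  define m where "m = card (B 1)"
  have con_A: "constructible_in X (A q)" for q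
    unfolding A_def P_def X_def W_def
    by (rule constructible_degenerating_to_unit_tensor[OF assms(1) src basis(2,3)])
  have bound: "q \<le> m" if "T \<in> W" "P T q" for T q
    using src.unit_tensor_degeneration_bound[OF assms(2)] that unfolding m_def P_def W_def by blast
  have P0: "P T 0" if T: "T \<in> W" for T
  proof -
    \<comment> \<open>Coordinates of such a tensor are indexed by maps from the nonempty set
      \<open>{1..d}\<close> to the empty set \<open>{1..0}\<close>. There are none, so the target
      space is zero and the unit tensor of size 0 is itself an image of \<open>T\<close>.\<close>
    have zero: "T' = 0" if "T' \<in> tensor_space fscale d (\<lambda>_. coord_space 0 :: (nat \<Rightarrow> 'k) set)" for T'
    proof -
      have "(\<Pi>\<^sub>E i\<in>{1..d}. {1..0::nat}) = {}" using assms(2) by (auto simp: PiE_eq_empty_iff)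
      then show ?thesis using coord_space.tensor_sum[OF that] by simp
    qed
    have "src.admissible 0 (\<lambda>_ _. 0)"
      using assms(1) vector_space_fscale by (auto simp: Vector_Spaces.linear_iff coord_space_def)
    then have "tensor_map fscale d (\<lambda>_ _. 0 :: nat \<Rightarrow> 'k) T = unit_tensor d 0"
      using zero unit_tensor_in_tensor_space src.tensor_map_in_tensor_space[OF _ T[unfolded W_def]]
      by metis
    then show ?thesis
      unfolding P_def src.in_degenerations_iff[OF T[unfolded W_def]]
      using \<open>src.admissible 0 (\<lambda>_ _. 0)\<close> by metis
  qed
  have eq: "{T \<in> W. border_subrank s d V T = q} = A q - (\<Union>q'\<in>{q<..m}. A q')" for q
  proof -
    have "border_subrank s d V T = q \<longleftrightarrow> P T q \<and> (\<forall>q'\<in>{q<..m}. \<not> P T q')" if "T \<in> W" for T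
      unfolding border_subrank_def P_def[symmetric]
      by (rule Greatest_eq_iff) (use P0 bound that in auto)
    then show ?thesis by (auto simp: A_def)
  qed
  have con_eq: "constructible_in X {T \<in> W. border_subrank s d V T = q}" for q
    unfolding eq by (intro constructible_in_Diff constructible_in_UN con_A) auto
  have less: "{T \<in> W. border_subrank s d V T < r} = (\<Union>q<r. {T \<in> W. border_subrank s d V T = q})"
    by auto
  have con_less: "constructible_in X {T \<in> W. border_subrank s d V T < r}"
    unfolding less by (intro constructible_in_UN con_eq) auto
  have "{T \<in> W. border_subrank s d V T \<ge> r} = topspace X - {T \<in> W. border_subrank s d V T < r}"
    unfolding X_def by auto
  then have "constructible_in X {T \<in> W. border_subrank s d V T \<ge> r}"
    using constructible_in_compl[OF con_less] by simp
  then show ?thesis using con_eq con_less unfolding X_def W_def by blast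
qed

end
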